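(* Let $f\in\mathcal G$ with $r>0$ and suppose that $f$ (on the positive half line) has a local minimum at $\beta$, $\beta>0$. Then $f$ has an inverse function $f^{-1}$ defined on $(f(\beta),\infty)$ (the inverse of the increasing restriction of $f$ to $(\beta,\infty)$) which can be extended to a univalent Pick-function defined in the cut plane $\mathbb C\setminus(-\infty,f(\beta)]$.
   Context: A Pick-function is a holomorphic function $p$ in the open upper half plane $\mathbb C_+$ with $\Im p(z)\ge0$ for all $z\in\mathbb C_+$; a Pick-function in a cut plane $\mathbb C\setminus(-\infty,c]$ is a holomorphic function there whose restriction to $\mathbb C_+$ is a Pick-function. Consider entire functions $f$ of the form $$f(z)=z^re^{az^2+bz}\prod_{k=1}^\infty\left(1+\frac z{\lambda_k}\right)e^{-z/\lambda_k+z^2/(2\lambda_k^2)},\qquad( * )$$ where $r$ is a non-negative integer, $a,b\in\mathbb R$, $0<\lambda_1\le\lambda_2\le\cdots$, $\sum_k\lambda_k^{-2}=\infty$ and $\sum_k\lambda_k^{-3}<\infty$. A function $f$ of the form $( * )$ is said to belong to the class $\mathcal G$ if it decreases on some open interval of the positive real line. If $f\in\mathcal G$ and $r>0$, there is a bounded interval $(\alpha,\beta)$ with $0<\alpha<\beta$ such that $f$ decreases on $(\alpha,\beta)$ and increases on $(0,\alpha)$ and on $(\beta,\infty)$. *)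

theory Defs
  imports "HOL-Complex_Analysis.Complex_Analysis"
begin

definition pick_function :: "(complex \<Rightarrow> complex) \<Rightarrow> bool" where
  "pick_function p \<longleftrightarrow>
     p holomorphic_on {z. Im z > 0} \<and> (\<forall>z. Im z > 0 \<longrightarrow> Im (p z) \<ge> 0)"

definition cut_plane :: "real \<Rightarrow> complex set" where
  "cut_plane c = - (complex_of_real ` {..c})"

definition pick_function_in_cut_plane :: "real \<Rightarrow> (complex \<Rightarrow> complex) \<Rightarrow> bool" where
  "pick_function_in_cut_plane c p \<longleftrightarrow> p holomorphic_on cut_plane c \<and> pick_function p"

(* The zeros are indexed from 0 instead of 1. *)
definition has_genus2_form ::
    "nat \<Rightarrow> real \<Rightarrow> real \<Rightarrow> (nat \<Rightarrow> real) \<Rightarrow> (complex \<Rightarrow> complex) \<Rightarrow> bool" where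
  "has_genus2_form r a b l f \<longleftrightarrow>
     (\<forall>k. l k > 0) \<and> incseq l \<and>
     \<not> summable (\<lambda>k. 1 / l k ^ 2) \<and> summable (\<lambda>k. 1 / l k ^ 3) \<and>
     (\<forall>z. f z = z ^ r * exp (of_real a * z\<^sup>2 + of_real b * z) *
        (\<Prod>k. (1 + z / of_real (l k)) *
              exp (- z / of_real (l k) + z\<^sup>2 / (2 * (of_real (l k))\<^sup>2))))"

(* Functions of the above form take real values on the real line
   (has_genus2_form_real below), so no information is lost by the real part. *)
definition on_reals :: "(complex \<Rightarrow> complex) \<Rightarrow> real \<Rightarrow> real" where
  "on_reals f x = Re (f (of_real x))"

definition class_G :: "(complex \<Rightarrow> complex) set" where
  "class_G = {f. (\<exists>r a b l. has_genus2_form r a b l f) \<and>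
     (\<exists>u v. 0 \<le> u \<and> u < v \<and> strict_antimono_on {u<..<v} (on_reals f))}"

lemma has_genus2_form_convergent:
  fixes z :: complex
  assumes "has_genus2_form r a b l f"
  shows "convergent_prod (\<lambda>k. (1 + z / of_real (l k)) *
           exp (- z / of_real (l k) + z\<^sup>2 / (2 * (of_real (l k))\<^sup>2)))"
proof -
  have pos: "l k > 0" for k
    using assms by (auto simp: has_genus2_form_def)
  have sm: "summable (\<lambda>k. 1 / l k ^ 3)"
    using assms by (auto simp: has_genus2_form_def)
  have "(\<lambda>k. 1 / l k ^ 3) \<longlonglongrightarrow> 0"
    using sm by (rule summable_LIMSEQ_zero)
  hence "(\<lambda>k. root 3 (1 / l k ^ 3)) \<longlonglongrightarrow> root 3 0"
    by (rule tendsto_real_root)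
  hence "(\<lambda>k. 1 / l k) \<longlonglongrightarrow> 0"
    using pos by (simp add: real_root_divide real_root_power_cancel less_imp_le)
  hence "(\<lambda>k. cmod z * (1 / l k)) \<longlonglongrightarrow> cmod z * 0"
    by (intro tendsto_mult tendsto_const)
  hence "\<forall>\<^sub>F k in sequentially. cmod z * (1 / l k) < 1 / 2"
    by (intro order_tendstoD(2)[where a = "1/2"]) auto
  hence ev: "\<forall>\<^sub>F k in sequentially.
      norm (norm (weierstrass_factor 2 (- z / of_real (l k)) - 1)) \<le> 3 * cmod z ^ 3 * (1 / l k ^ 3)"
  proof eventually_elim
    case (elim k)
    have n: "norm (- z / of_real (l k)) = cmod z / l k"
      using pos[of k] by (simp add: norm_divide)
    have "norm (weierstrass_factor 2 (- z / of_real (l k)) - 1)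
            \<le> 3 * norm (- z / of_real (l k)) ^ Suc 2"
      using elim n by (intro weierstrass_factor_bound) auto
    thus ?case
      unfolding n by (simp add: power_divide)
  qed
  have "summable (\<lambda>k. norm (weierstrass_factor 2 (- z / of_real (l k)) - 1))"
    by (rule summable_comparison_test_ev[OF ev]) (intro summable_mult sm)
  hence "convergent_prod (\<lambda>k. weierstrass_factor 2 (- z / of_real (l k)))"
    by (intro abs_convergent_prod_imp_convergent_prod summable_imp_abs_convergent_prod)
  also have "(\<lambda>k. weierstrass_factor 2 (- z / of_real (l k))) =
      (\<lambda>k. (1 + z / of_real (l k)) *
           exp (- z / of_real (l k) + z\<^sup>2 / (2 * (of_real (l k))\<^sup>2)))"
    by (simp add: weierstrass_factor_def eval_nat_numeral fun_eq_iff power2_eq_square field_simps)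
  finally show ?thesis .
qed

lemma has_genus2_form_real:
  assumes "has_genus2_form r a b l f"
  shows "f (of_real x) = of_real (on_reals f x)"
proof -
  define g where "g = (\<lambda>k. (1 + x / l k) * exp (- x / l k + x\<^sup>2 / (2 * (l k)\<^sup>2)))"
  have eq: "(1 + complex_of_real x / of_real (l k)) *
      exp (- of_real x / of_real (l k) + (of_real x)\<^sup>2 / (2 * (of_real (l k))\<^sup>2)) = of_real (g k)" for k
    by (simp add: g_def flip: exp_of_real)
  have "convergent_prod (complex_of_real \<circ> g)"
    using has_genus2_form_convergent[OF assms, of "of_real x"] unfolding eq o_def .
  hence "g has_prod prodinf g"
    using convergent_prod_of_real_iff convergent_prod_has_prod by blast
  hence "(\<lambda>k. complex_of_real (g k)) has_prod of_real (prodinf g)"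
    by simp
  hence "(\<Prod>k. complex_of_real (g k)) = of_real (prodinf g)"
    using has_prod_unique by metis
  hence "f (of_real x) =
      of_real (x ^ r * exp (a * x\<^sup>2 + b * x) * prodinf g)"
    using assms unfolding has_genus2_form_def by (simp only: eq) (simp flip: exp_of_real)
  thus ?thesis
    by (simp add: on_reals_def)
qed

end

(*
  Inverse branches are constructed for polynomial approximations of f and then carried to the limit.

  Replacing the exponential by a power of a positive quadratic Q and truncating the product turns f
  into a real polynomial P with P' / P = R / Q, where R is a partial fraction with poles at 0 and
  at the -l k plus an affine function. Since f decreases somewhere on the positive axis, R has two
  positive zeros u < v. The second divided difference of an affine function vanishes, so
  R z = (z - u) (z - v) S z with a Stieltjes function S. Hence R has no zeros in the upper half
  plane, and the critical points of P there are zeros of P. As P is proper and real on the real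
  axis, it is a covering of the upper half plane by the set where z and P z both have positive
  imaginary part. Lifting the identity gives an inverse branch through any prescribed point.
  These branches form a normal family (after a Cayley transform), and their limits are inverse
  branches of f.

  On the positive axis f' / f is a limit of convex functions, so f increases from beta to infinity.
  Near the half line to the right of beta the inverse branch of f is the analytic continuation of
  the real inverse, so reflection extends it to the cut plane. It is univalent, being a right
  inverse of f.
*)
theory Submission
  imports Defs "HOL-Real_Asymp.Real_Asymp"
begin

section \<open>Coverings of the upper half plane\<close>

abbreviation upper_half_plane :: "complex set" ("\<H>") where
  "\<H> \<equiv> {z. Im z > 0}"

text \<open>The value at \<open>F z0\<close> selects one branch. It also keeps a limit of such
  branches from degenerating into a boundary constant.\<close>

definition upper_inverse_through :: "complex \<Rightarrow> (complex \<Rightarrow> complex) \<Rightarrow> (complex \<Rightarrow> complex) \<Rightarrow> bool" where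
  "upper_inverse_through z0 F g \<longleftrightarrow>
     g holomorphic_on \<H> \<and> g \<in> \<H> \<rightarrow> \<H> \<and> (\<forall>w\<in>\<H>. F (g w) = w) \<and> g (F z0) = z0"

text \<open>On the real axis \<open>F\<close> is real, so no fibre over the open half plane can
  approach the boundary of \<open>C\<close> at finite points, and properness excludes infinity. Thus
  \<open>F\<close> restricted to \<open>C\<close> is a proper local homeomorphism onto a connected
  set.\<close>

lemma proper_real_entire_covering_upper_half_plane:
  assumes holo: "F holomorphic_on UNIV"
    and proper: "filterlim F at_infinity at_infinity"
    and real: "\<And>x. F (of_real x) \<in> \<real>"
    and crit: "\<And>z. Im z > 0 \<Longrightarrow> Im (F z) > 0 \<Longrightarrow> deriv F z \<noteq> 0"
    and ne: "Im z0 > 0" "Im (F z0) > 0"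
  defines "C \<equiv> {z. Im z > 0 \<and> Im (F z) > 0}"
  shows "open C" "covering_space C F \<H>"
proof -
  have cont: "continuous_on A F" for A
    using holo holomorphic_on_imp_continuous_on continuous_on_subset by blast
  have holoA: "F holomorphic_on A" for A
    using holo holomorphic_on_subset by blast
  show "open C"
    unfolding C_def by (intro open_Collect_conj open_Collect_less continuous_intros cont)
  have openH: "open \<H>"
    by (rule open_halfspace_Im_gt)
  have bdd: "\<exists>R. \<forall>z. F z \<in> ball w 1 \<longrightarrow> norm z \<le> R" for w
  proof -
    have "eventually (\<lambda>z. norm w + 1 \<le> norm (F z)) at_infinity"
      using filterlim_at_infinity_imp_norm_at_top[OF proper] by (simp add: filterlim_at_top)
    then obtain R where R: "\<And>z. norm z \<ge> R \<Longrightarrow> norm w + 1 \<le> norm (F z)"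
      by (auto simp: eventually_at_infinity)
    have "norm z \<le> R" if "F z \<in> ball w 1" for z
    proof (rule ccontr)
      assume "\<not> norm z \<le> R"
      hence "norm w + 1 \<le> norm (F z)"
        using R by simp
      moreover have "norm (F z) < norm w + 1"
        using that norm_triangle_ineq2[of "F z" w] by (simp add: dist_norm norm_minus_commute)
      ultimately show False by simp
    qed
    thus ?thesis by blast
  qed
  \<comment> \<open>Properness as a tube property: if \<open>U\<close> contains the fibre over
    \<open>w\<close>, it contains the fibres over nearby points. The points to be avoided form a
    compact set \<open>K\<close> in the closed half plane, whose image misses \<open>w\<close>
    because real points have real values.\<close>
  have tube: "\<exists>T. open T \<and> w \<in> T \<and> T \<subseteq> \<H> \<and> C \<inter> F -` T \<subseteq> U"
    if w: "w \<in> \<H>" and U: "open U" "\<And>z. z \<in> C \<Longrightarrow> F z = w \<Longrightarrow> z \<in> U" for w U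
  proof -
    obtain R where R: "\<And>z. F z \<in> ball w 1 \<Longrightarrow> norm z \<le> R"
      using bdd by blast
    define K where "K = (cball 0 R \<inter> {z. Im z \<ge> 0}) - U"
    have "compact K"
      unfolding K_def by (intro compact_diff compact_Int_closed closed_halfspace_Im_ge U) auto
    hence "compact (F ` K)"
      by (intro compact_continuous_image cont)
    hence cl: "closed (F ` K)"
      by (rule compact_imp_closed)
    have "w \<notin> F ` K"
    proof
      assume "w \<in> F ` K"
      then obtain z where z: "Im z \<ge> 0" "z \<notin> U" "F z = w"
        by (auto simp: K_def)
      have "Im z \<noteq> 0"
      proof
        assume "Im z = 0"
        hence "z = of_real (Re z)" by (simp add: complex_eq_iff)
        hence "F z \<in> \<real>" using real by metis
        thus False using z w by (auto simp: complex_is_Real_iff)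
      qed
      thus False using U(2)[of z] z w by (auto simp: C_def)
    qed
    hence "open (ball w 1 \<inter> \<H> - F ` K)" "w \<in> ball w 1 \<inter> \<H> - F ` K"
      using cl w openH by auto
    moreover have "C \<inter> F -` (ball w 1 \<inter> \<H> - F ` K) \<subseteq> U"
      using R by (auto simp: K_def C_def)
    ultimately show ?thesis by (intro exI[of _ "ball w 1 \<inter> \<H> - F ` K"]) auto
  qed
  have inj: "\<exists>r>0. ball z r \<subseteq> C \<and> inj_on F (ball z r)" if "z \<in> C" for z
    using has_complex_derivative_locally_injective[OF holoA[of C] that \<open>open C\<close>] crit[of z] that
    by (metis (lifting) C_def mem_Collect_eq)
  have "open (F ` C)"
  proof (subst open_subopen, clarify)
    fix z assume z: "z \<in> C"
    then obtain r where r: "r > 0" "ball z r \<subseteq> C" "inj_on F (ball z r)"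
      using inj by blast
    have "open (F ` ball z r)"
      by (rule open_mapping_thm3) (use r holoA in auto)
    thus "\<exists>T. open T \<and> F z \<in> T \<and> T \<subseteq> F ` C"
      using r by (intro exI[of _ "F ` ball z r"]) auto
  qed
  moreover have "open (\<H> - F ` C)"
  proof (subst open_subopen, rule ballI)
    fix w assume w: "w \<in> \<H> - F ` C"
    \<comment> \<open>An empty fibre is contained in the empty set, so nearby fibres are empty too:
      the image is closed relative to the half plane.\<close>
    then obtain T where "open T" "w \<in> T" "T \<subseteq> \<H>" "C \<inter> F -` T \<subseteq> {}"
      using tube[of w "{}"] by blast
    thus "\<exists>T. open T \<and> w \<in> T \<and> T \<subseteq> \<H> - F ` C"
      by (intro exI[of _ T]) auto
  qed
  moreover have "F ` C \<subseteq> \<H>"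
    by (auto simp: C_def)
  moreover have "F z0 \<in> F ` C"
    using ne by (auto simp: C_def)
  ultimately have surj: "F ` C = \<H>"
    using connectedD[OF connected_halfspace_Im_gt[of 0], of "F ` C" "\<H> - F ` C"] by blast
  show "covering_space C F \<H>"
  proof (rule covering_spaceI[OF cont surj])
    fix w assume w: "w \<in> \<H>"
    define K where "K = {z\<in>C. F z = w}"
    obtain r where r: "\<And>z. z \<in> C \<Longrightarrow> r z > 0" "\<And>z. z \<in> C \<Longrightarrow> ball z (r z) \<subseteq> C"
        "\<And>z. z \<in> C \<Longrightarrow> inj_on F (ball z (r z))"
      using inj by metis
    \<comment> \<open>Injectivity on \<open>ball z (r z)\<close> puts the other points of the fibre
      at distance at least \<open>r z\<close>. Halving the radii therefore makes the sheets
      disjoint.\<close>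
    define B where "B = (\<lambda>z. ball z (r z / 2))"
    have BC: "B z \<subseteq> ball z (r z)" "B z \<subseteq> C" "inj_on F (B z)" "open (F ` B z)" "z \<in> B z" if "z \<in> C" for z
    proof -
      show *: "B z \<subseteq> ball z (r z)" "B z \<subseteq> C" "inj_on F (B z)"
        using r[OF that] by (auto simp: B_def intro: inj_on_subset)
      show "open (F ` B z)"
        by (rule open_mapping_thm3) (use * holoA in \<open>auto simp: B_def\<close>)
      show "z \<in> B z" using r(1)[OF that] by (simp add: B_def)
    qed
    have sep: "dist z z' \<ge> r z" if "z \<in> K" "z' \<in> K" "z \<noteq> z'" for z z'
      using r(1,3)[of z] that by (force simp: K_def inj_on_def)
    \<comment> \<open>Closed conditions in place of the open ones that define \<open>C\<close>, so
      that the fibre is visibly closed.\<close>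
    have Keq: "K = {z. Im z \<ge> 0 \<and> F z = w}"
    proof -
      have "Im z \<noteq> 0" if "F z = w" for z
      proof
        assume "Im z = 0"
        hence "z = of_real (Re z)" by (simp add: complex_eq_iff)
        hence "F z \<in> \<real>" using real by metis
        thus False using that w by (auto simp: complex_is_Real_iff)
      qed
      thus ?thesis using w by (force simp: K_def C_def)
    qed
    have "compact K"
      unfolding compact_eq_bounded_closed
    proof
      obtain R where R: "\<And>z. F z \<in> ball w 1 \<Longrightarrow> norm z \<le> R"
        using bdd by blast
      show "bounded K"
        by (rule boundedI[of _ R]) (auto simp: K_def intro!: R)
      show "closed K"
        unfolding Keq by (intro closed_Collect_conj closed_Collect_le closed_Collect_eq continuous_intros cont)
    qed
    then obtain D where D: "D \<subseteq> K" "finite D" "K \<subseteq> (\<Union>z\<in>D. ball z (r z))"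
      using compactE_image[of K K "\<lambda>z. ball z (r z)"] r(1) by (force simp: K_def)
    have "K \<subseteq> D"
    proof
      fix z assume z: "z \<in> K"
      then obtain d where d: "d \<in> D" "z \<in> ball d (r d)" using D by blast
      thus "z \<in> D" using sep[of d z] D z by force
    qed
    hence fin: "finite K" using D finite_subset by blast
    have "open (\<Union>z\<in>K. B z)"
      by (auto simp: B_def)
    then obtain T0 where T0: "open T0" "w \<in> T0" "T0 \<subseteq> \<H>" "C \<inter> F -` T0 \<subseteq> (\<Union>z\<in>K. B z)"
      using tube[OF w, of "\<Union>z\<in>K. B z"] BC(5) by (force simp: K_def)
    \<comment> \<open>The fibre is finite, so this intersection is still open. It makes each sheet
      map onto all of \<open>T\<close>.\<close>
    define T where "T = T0 \<inter> (\<Inter>z\<in>K. F ` B z)"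
    have T: "open T" "w \<in> T" "T \<subseteq> \<H>"
      using T0 fin BC by (auto simp: T_def K_def intro!: open_INT)
    define u where "u = (\<lambda>z. B z \<inter> F -` T)"
    have openu: "open (u z)" for z
      unfolding u_def using cont T(1)
      by (intro continuous_open_preimage) (auto simp: B_def)
    have "\<Union> (u ` K) = C \<inter> F -` T"
      using T0(4) BC(2) by (auto simp: u_def T_def K_def)
    moreover have "\<forall>x\<in>u ` K. openin (top_of_set C) x"
    proof clarify
      fix z assume "z \<in> K"
      hence "u z \<subseteq> C" using BC(2)[of z] by (auto simp: u_def K_def)
      thus "openin (top_of_set C) (u z)"
        using openu \<open>open C\<close> by (simp add: openin_open_eq)
    qed
    moreover have "pairwise disjnt (u ` K)"
    proof (rule pairwise_imageI)
      fix z z' assume z: "z \<in> K" "z' \<in> K" "z \<noteq> z'"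
      show "disjnt (u z) (u z')"
        unfolding disjnt_iff
      proof (intro allI notI)
        fix x assume "x \<in> u z \<and> x \<in> u z'"
        hence "dist z x < r z / 2" "dist z' x < r z' / 2"
          by (auto simp: u_def B_def)
        hence "dist z z' < r z / 2 + r z' / 2"
          using dist_triangle[of z z' x] by (simp add: dist_commute)
        thus False using sep[of z z'] sep[of z' z] z by (simp add: dist_commute)
      qed
    qed
    moreover have "\<exists>q. homeomorphism (u z) T F q" if "z \<in> K" for z
    proof -
      have zC: "z \<in> C" using that by (simp add: K_def)
      have injB: "inj_on F (B z)" using BC zC by blast
      have inju: "inj_on F (u z)"
        by (rule inj_on_subset[OF injB]) (auto simp: u_def)
      obtain q where q: "q holomorphic_on F ` u z" "\<And>x. x \<in> u z \<Longrightarrow> q (F x) = x"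
        by (rule holomorphic_has_inverse[OF holoA openu inju], rule that)
      have "T \<subseteq> F ` u z"
      proof
        fix x assume x: "x \<in> T"
        hence "x \<in> F ` B z" using \<open>z \<in> K\<close> by (auto simp: T_def)
        then obtain y where "y \<in> B z" "F y = x" by blast
        thus "x \<in> F ` u z" using x by (auto simp: u_def)
      qed
      hence img: "F ` u z = T"
        by (auto simp: u_def)
      have "homeomorphism (u z) T F q"
        unfolding homeomorphism_def
        using q img cont holomorphic_on_imp_continuous_on[OF q(1)]
        by (auto simp: image_iff)
      thus ?thesis by blast
    qed
    ultimately show "\<exists>T. w \<in> T \<and> openin (top_of_set \<H>) T \<and>
        (\<exists>v. \<Union> v = C \<inter> F -` T \<and> (\<forall>u\<in>v. openin (top_of_set C) u) \<and> pairwise disjnt v \<and>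
             (\<forall>u\<in>v. \<exists>q. homeomorphism u T F q))"
      using T openH by (intro exI[of _ T] conjI exI[of _ "u ` K"]) (auto simp: openin_open_eq)
  qed
qed

text \<open>The half plane is simply connected, so its identity map lifts through the covering; the
  lift starting at \<open>z0\<close> is the branch.\<close>

lemma proper_real_entire_upper_inverse:
  assumes "F holomorphic_on UNIV"
    and "filterlim F at_infinity at_infinity"
    and "\<And>x. F (of_real x) \<in> \<real>"
    and "\<And>z. Im z > 0 \<Longrightarrow> Im (F z) > 0 \<Longrightarrow> deriv F z \<noteq> 0"
    and z0: "Im z0 > 0" "Im (F z0) > 0"
  shows "\<exists>g. upper_inverse_through z0 F g"
proof -
  define C where "C = {z. Im z > 0 \<and> Im (F z) > 0}"
  have C: "open C" and cov: "covering_space C F \<H>"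
    using proper_real_entire_covering_upper_half_plane[OF assms] unfolding C_def by blast+
  have H: "simply_connected \<H>" "locally path_connected \<H>"
    by (auto intro!: convex_imp_simply_connected convex_imp_locally_path_connected convex_halfspace_Im_gt)
  obtain g where g: "continuous_on \<H> g" "g \<in> \<H> \<rightarrow> C" "g (F z0) = z0" "\<And>y. y \<in> \<H> \<Longrightarrow> F (g y) = y"
    by (rule covering_space_lift_strong[OF cov _ _ H, of z0 "F z0" "\<lambda>w. w"]) (use z0 in \<open>auto simp: C_def\<close>)
  have "F holomorphic_on C" using assms(1) holomorphic_on_subset by blast
  hence "g holomorphic_on \<H>"
    using covering_space_lift_is_holomorphic[OF cov C, of "\<lambda>w. w" \<H> g] g by (auto simp: Pi_iff)
  thus ?thesis
    unfolding upper_inverse_through_def using g by (intro exI[of _ g]) (auto simp: C_def Pi_iff)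
qed

section \<open>Limits of inverse branches\<close>

text \<open>Pointwise convergence would not suffice below, where the functions and their arguments
  vary together.\<close>

lemma uniform_limit_imp_tendsto_diagonal:
  fixes f :: "'a::metric_space \<Rightarrow> 'b::metric_space"
  assumes ul: "uniform_limit K F f sequentially" and cont: "continuous_on K f"
    and X: "X \<longlonglongrightarrow> x" "x \<in> K" "\<forall>\<^sub>F n in sequentially. X n \<in> K"
  shows "(\<lambda>n. F n (X n)) \<longlonglongrightarrow> f x"
proof (rule tendstoI)
  fix e :: real assume e: "e > 0"
  have "(\<lambda>n. f (X n)) \<longlonglongrightarrow> f x"
    by (rule continuous_on_tendsto_compose[OF cont X])
  hence "\<forall>\<^sub>F n in sequentially. dist (f (X n)) (f x) < e / 2"
    using e by (intro tendstoD) auto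
  moreover have "\<forall>\<^sub>F n in sequentially. \<forall>y\<in>K. dist (F n y) (f y) < e / 2"
    using uniform_limitD[OF ul, of "e/2"] e by simp
  ultimately show "\<forall>\<^sub>F n in sequentially. dist (F n (X n)) (f x) < e"
    using X(3)
  proof eventually_elim
    case (elim n)
    hence "dist (F n (X n)) (f (X n)) < e / 2" by blast
    thus ?case using elim(1) dist_triangle[of "F n (X n)" "f x" "f (X n)"] by linarith
  qed
qed

section \<open>The Cayley transform between the upper half plane and the unit disc\<close>

lemma Im_Cayley: "w \<noteq> 1 \<Longrightarrow> Im (\<i> * (1 + w) / (1 - w)) = (1 - (cmod w)\<^sup>2) / (cmod (1 - w))\<^sup>2"
  by (simp add: complex_eq_iff cmod_power2 Im_divide) (simp add: power2_eq_square algebra_simps)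

lemma norm_Cayley_less_1: "Im z > 0 \<Longrightarrow> norm ((z - \<i>) / (z + \<i>)) < 1"
proof -
  assume z: "Im z > 0"
  have "(norm (z - \<i>))\<^sup>2 < (norm (z + \<i>))\<^sup>2"
    using z unfolding cmod_power2 by (simp add: power2_eq_square algebra_simps)
  hence "norm (z - \<i>) < norm (z + \<i>)"
    by (rule power_less_imp_less_base) simp
  thus ?thesis by (simp add: norm_divide divide_simps) 
qed

lemma Cayley_inverse:
  assumes "Im z > 0"
  shows "\<i> * (1 + (z - \<i>) / (z + \<i>)) / (1 - (z - \<i>) / (z + \<i>)) = z"
proof -
  have ne: "z + \<i> \<noteq> 0" using assms by (auto simp: complex_eq_iff)
  have "1 + (z - \<i>) / (z + \<i>) = 2 * z / (z + \<i>)" "1 - (z - \<i>) / (z + \<i>) = 2 * \<i> / (z + \<i>)"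
    using ne by (simp_all add: field_simps)
  thus ?thesis using ne by simp
qed

text \<open>Cayley transforms of the branches are bounded by 1, so Montel's theorem gives a
  convergent subsequence. The common value \<open>z0\<close> forces the limit to stay inside the
  disc, and the equation \<open>P n (G n w) = w\<close> passes to the limit.\<close>

lemma upper_inverse_through_limit:
  assumes inv: "\<forall>\<^sub>F n in sequentially. \<exists>g. upper_inverse_through z0 (F n) g"
    and lim: "\<And>R. uniform_limit (cball 0 R) F f sequentially"
    and cont: "continuous_on UNIV f"
    and z0: "Im z0 > 0" "Im (f z0) > 0"
  shows "\<exists>g. upper_inverse_through z0 f g"
proof -
  obtain N where N: "\<And>n. n \<ge> N \<Longrightarrow> \<exists>g. upper_inverse_through z0 (F n) g"
    using inv by (auto simp: eventually_sequentially)
  define P where "P = (\<lambda>n. F (n + N))"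
  have "\<forall>n. \<exists>g. upper_inverse_through z0 (P n) g"
    using N by (simp add: P_def)
  then obtain G where G: "\<And>n. upper_inverse_through z0 (P n) (G n)"
    by metis
  have G_holo: "G n holomorphic_on \<H>" and G_Im: "w \<in> \<H> \<Longrightarrow> Im (G n w) > 0"
    and G_inv: "w \<in> \<H> \<Longrightarrow> P n (G n w) = w" and G_z0: "G n (P n z0) = z0" for n w
    using G[of n] unfolding upper_inverse_through_def by auto
  have openH: "open \<H>" by (rule open_halfspace_Im_gt)
  define k where "k = (\<lambda>n w. (G n w - \<i>) / (G n w + \<i>))"
  have k_norm: "norm (k n w) < 1" if "w \<in> \<H>" for n w
    unfolding k_def using norm_Cayley_less_1[OF G_Im[OF that]] .
  have k_holo: "k n holomorphic_on \<H>" for n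
    unfolding k_def
  proof (intro holomorphic_intros G_holo)
    fix w assume "w \<in> \<H>"
    thus "G n w + \<i> \<noteq> 0" using G_Im[of w n] by (auto simp: complex_eq_iff)
  qed
  obtain h s where h: "h holomorphic_on \<H>" "strict_mono s"
      "\<And>w. w \<in> \<H> \<Longrightarrow> (\<lambda>n. k (s n) w) \<longlonglongrightarrow> h w"
      "\<And>K. compact K \<Longrightarrow> K \<subseteq> \<H> \<Longrightarrow> uniform_limit K (k \<circ> s) h sequentially"
  proof (rule Montel[of \<H> "{h. h holomorphic_on \<H> \<and> (\<forall>w\<in>\<H>. norm (h w) \<le> 1)}" k, OF openH])
    show "\<exists>B. \<forall>h\<in>{h. h holomorphic_on \<H> \<and> (\<forall>w\<in>\<H>. norm (h w) \<le> 1)}. \<forall>z\<in>K. norm (h z) \<le> B"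
      if "compact K" "K \<subseteq> \<H>" for K
      using that by (intro exI[of _ 1]) auto
    show "range k \<subseteq> {h. h holomorphic_on \<H> \<and> (\<forall>w\<in>\<H>. norm (h w) \<le> 1)}"
      using k_holo k_norm less_imp_le by blast
  qed auto
  have limP: "uniform_limit (cball 0 R) (P \<circ> s) f sequentially" for R
  proof -
    have "filterlim (\<lambda>n. s n + N) sequentially sequentially"
      using filterlim_subseq[OF h(2)] 
      by (rule filterlim_at_top_mono) auto
    from filterlim_compose[OF lim[of R] this] show ?thesis
      by (simp add: P_def o_def)
  qed
  have P_diag: "(\<lambda>n. P (s n) (X n)) \<longlonglongrightarrow> f x" if "X \<longlonglongrightarrow> x" for X x
  proof -
    have "\<forall>\<^sub>F n in sequentially. norm (X n) < norm x + 1"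
      using tendsto_norm[OF that] by (rule order_tendstoD) simp
    hence "\<forall>\<^sub>F n in sequentially. X n \<in> cball 0 (norm x + 1)"
      by eventually_elim auto
    thus ?thesis
      using uniform_limit_imp_tendsto_diagonal[OF limP _ that, of "norm x + 1"] cont
        continuous_on_subset[OF cont] by (simp add: o_def)
  qed
  define w0 where "w0 = f z0"
  have w0: "w0 \<in> \<H>" using z0 by (simp add: w0_def)
  have Pz0: "(\<lambda>n. P (s n) z0) \<longlonglongrightarrow> w0"
    unfolding w0_def by (rule P_diag) simp
  \<comment> \<open>The base point \<open>P (s n) z0\<close> moves with \<open>n\<close>, hence the
    uniform convergence on a disc around \<open>w0\<close>.\<close>
  have h_w0: "h w0 = (z0 - \<i>) / (z0 + \<i>)"
  proof -
    obtain e where e: "e > 0" "cball w0 e \<subseteq> \<H>"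
      using w0 openH open_contains_cball by blast
    have "\<forall>\<^sub>F n in sequentially. P (s n) z0 \<in> cball w0 e"
      using tendstoD[OF Pz0 e(1)] by eventually_elim (simp add: dist_commute)
    hence "(\<lambda>n. (k \<circ> s) n (P (s n) z0)) \<longlonglongrightarrow> h w0"
      using e Pz0 holomorphic_on_imp_continuous_on[OF h(1)]
      by (intro uniform_limit_imp_tendsto_diagonal[OF h(4)[OF compact_cball e(2)]])
         (auto intro: continuous_on_subset)
    moreover have "(k \<circ> s) n (P (s n) z0) = (z0 - \<i>) / (z0 + \<i>)" for n
      by (simp add: k_def G_z0)
    ultimately show ?thesis
      by (simp add: LIMSEQ_const_iff)
  qed
  have h_le: "norm (h w) \<le> 1" if "w \<in> \<H>" for w
    using tendsto_norm[OF h(3)[OF that]] k_norm[OF that]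
    by (intro tendsto_upperbound[of _ "norm (h w)"]) (auto intro!: always_eventually less_imp_le)
  \<comment> \<open>If the limit touched the unit circle, the maximum principle would make it
    constant, against its interior value at \<open>w0\<close>.\<close>
  have h_less: "norm (h w) < 1" if w: "w \<in> \<H>" for w
  proof (rule ccontr)
    assume "\<not> norm (h w) < 1"
    hence eq: "norm (h w) = 1" using h_le[OF w] by simp
    have "h constant_on \<H>"
      by (rule maximum_modulus_principle[OF h(1) openH connected_halfspace_Im_gt openH _ w])
         (use eq h_le in auto)
    hence "h w = h w0" using w w0 by (auto simp: constant_on_def)
    thus False using eq h_w0 norm_Cayley_less_1[OF z0(1)] by simp
  qed
  have h_ne: "h w \<noteq> 1" if "w \<in> \<H>" for w
    using h_less[OF that] by auto
  define g where "g = (\<lambda>w. \<i> * (1 + h w) / (1 - h w))"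
  have "g holomorphic_on \<H>"
    unfolding g_def using h_ne by (intro holomorphic_intros h) auto
  moreover have "g \<in> \<H> \<rightarrow> \<H>"
  proof
    fix w assume w: "w \<in> \<H>"
    have "(cmod (h w))\<^sup>2 < 1"
      using h_less[OF w] by (simp add: abs_square_less_1)
    thus "g w \<in> \<H>"
      using h_ne[OF w] by (simp add: g_def Im_Cayley del: Im_divide)
  qed
  moreover have "f (g w) = w" if w: "w \<in> \<H>" for w
  proof -
    have "(\<lambda>n. \<i> * (1 + k (s n) w) / (1 - k (s n) w)) \<longlonglongrightarrow> g w"
      unfolding g_def using h_ne[OF w] by (intro tendsto_intros h w) auto
    hence "(\<lambda>n. G (s n) w) \<longlonglongrightarrow> g w"
      using Cayley_inverse[OF G_Im[OF w]] by (simp add: k_def)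
    hence "(\<lambda>n. P (s n) (G (s n) w)) \<longlonglongrightarrow> f (g w)"
      by (rule P_diag)
    thus ?thesis
      using G_inv[OF w] by (simp add: LIMSEQ_const_iff)
  qed
  moreover have "g (f z0) = z0"
    using h_w0 Cayley_inverse[OF z0(1)] by (simp add: g_def w0_def)
  ultimately show ?thesis
    unfolding upper_inverse_through_def by blast
qed

section \<open>Polynomial approximation\<close>

text \<open>The factor \<open>E\<close> is left open since the formula is applied both to a power of
  a quadratic and to the exponential itself.\<close>

lemma has_field_derivative_linear_factors:
  fixes l :: "nat \<Rightarrow> real" and z :: complex
  assumes l: "\<And>k. l k \<noteq> 0" and z: "z \<noteq> 0" "\<And>k. z + of_real (l k) \<noteq> 0"
    and E: "(E has_field_derivative E z * e) (at z)"
  shows "((\<lambda>z. z ^ r * E z * (\<Prod>k<n. 1 + z / of_real (l k))) has_field_derivative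
           (z ^ r * E z * (\<Prod>k<n. 1 + z / of_real (l k))) *
             (of_nat r / z + e + (\<Sum>k<n. 1 / (z + of_real (l k))))) (at z)"
proof -
  have prod: "((\<lambda>z. \<Prod>k<n. 1 + z / of_real (l k)) has_field_derivative
      (\<Prod>k<n. 1 + z / of_real (l k)) * (\<Sum>k<n. 1 / (z + of_real (l k)))) (at z)"
  proof (induction n)
    case (Suc n)
    have "((\<lambda>z. 1 + z / complex_of_real (l n)) has_field_derivative
            (1 + z / of_real (l n)) * (1 / (z + of_real (l n)))) (at z)"
      by (rule derivative_eq_intros refl | use l[of n] z(2)[of n] in \<open>simp add: field_simps\<close>)+
    from DERIV_mult[OF Suc this] show ?case
      unfolding prod.lessThan_Suc sum.lessThan_Suc by (rule DERIV_cong) (simp only: algebra_simps)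
  qed simp
  have "((\<lambda>z. z ^ r) has_field_derivative z ^ r * (of_nat r / z)) (at z)"
    by (rule DERIV_cong[OF DERIV_power[OF DERIV_ident]]) (use z(1) in \<open>cases r; simp\<close>)
  from DERIV_mult[OF DERIV_mult[OF this E] prod] show ?thesis
    by (rule DERIV_cong) (simp only: algebra_simps)
qed

lemma linear_factor_nonzero:
  assumes "l > 0" "z \<noteq> 0" "Im z = 0 \<Longrightarrow> Re z > 0"
  shows "z + of_real l \<noteq> 0" "1 + z / of_real l \<noteq> 0"
proof -
  show *: "z + of_real l \<noteq> 0" using assms by (auto simp: complex_eq_iff)
  have "1 + z / of_real l = (z + of_real l) / of_real l" using assms(1) by (simp add: field_simps)
  thus "1 + z / of_real l \<noteq> 0" using * assms by simp
qed

text \<open>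
  The two sides are \<open>(z - u) (z - v) (u - v)\<close> times the second divided difference of
  \<open>x \<mapsto> Q x / (x + c)\<close> at \<open>z, u, v\<close>. This functional vanishes on the affine part of
  \<open>Q x / (x + c)\<close>.
\<close>
lemma divided_difference_quadratic_over_linear:
  fixes z u v c p q :: "'a::field"
  assumes "z + c \<noteq> 0" "u + c \<noteq> 0" "v + c \<noteq> 0"
  defines "Q \<equiv> \<lambda>z. 1 + p * z\<^sup>2 + q * z"
  shows "Q z / (z + c) * (u - v) - Q u / (u + c) * (z - v) + Q v / (v + c) * (z - u)
           = (z - u) * (z - v) * (u - v) * (Q (- c) / ((z + c) * (u + c) * (v + c)))"
proof -
  have "Q x / (x + c) = Q (- c) / (x + c) + p * (x - c) + q" if "x + c \<noteq> 0" for x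
    using that by (simp add: Q_def field_simps power2_eq_square)
  hence "Q z / (z + c) * (u - v) - Q u / (u + c) * (z - v) + Q v / (v + c) * (z - u) =
      (Q (- c) / (z + c) + p * (z - c) + q) * (u - v) - (Q (- c) / (u + c) + p * (u - c) + q) * (z - v)
      + (Q (- c) / (v + c) + p * (v - c) + q) * (z - u)"
    using assms by simp
  also have "\<dots> = Q (- c) * ((u - v) / (z + c) - (z - v) / (u + c) + (z - u) / (v + c))"
    by (simp add: algebra_simps diff_divide_distrib)
  also have "(u - v) / (z + c) - (z - v) / (u + c) + (z - u) / (v + c) =
      (z - u) * (z - v) * (u - v) / ((z + c) * (u + c) * (v + c))"
  proof -
    have "(b - d) / a - (a - d) / b + (a - b) / d = (a - b) * (a - d) * (b - d) / (a * b * d)"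
      if "a \<noteq> 0" "b \<noteq> 0" "d \<noteq> 0" for a b d :: 'a
      using that by (simp add: field_simps)
    from this[OF assms(1-3)] show ?thesis by simp
  qed
  finally show ?thesis by simp
qed

lemma Im_of_real_divide_neg:
  assumes "c > 0" "Im z > 0"
  shows "Im (of_real c / (z + of_real t)) < 0"
proof -
  have "0 < (Re z + t)\<^sup>2 + (Im z)\<^sup>2"
    using assms by (intro add_nonneg_pos) auto
  thus ?thesis
    using assms by (simp add: Im_divide divide_simps)
qed

text \<open>
  With two positive zeros \<open>u < x < v\<close> supplied by the intermediate value theorem, the expression
  is \<open>(z - u) (z - v)\<close> times a Stieltjes function with positive weights, and such a function has
  negative imaginary part in the upper half plane.
\<close>
lemma stieltjes_quotient_nonzero:
  fixes l :: "nat \<Rightarrow> real" and p q A B x :: real and r n :: nat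
  defines "Q \<equiv> \<lambda>x::real. 1 + p * x\<^sup>2 + q * x"
  defines "R \<equiv> \<lambda>x::real. Q x * (of_nat r / x + (\<Sum>k<n. 1 / (x + l k))) + 2 * A * x + B"
  assumes r: "r > 0" and A: "A > 0" and p: "p > 0" and disc: "q\<^sup>2 < 4 * p"
    and l: "\<And>k. l k > 0" and x: "x > 0" "R x < 0" and z: "Im z > 0"
  shows "(1 + of_real p * z\<^sup>2 + of_real q * z) *
           (of_nat r / z + (\<Sum>k<n. 1 / (z + of_real (l k)))) + 2 * of_real A * z + of_real B \<noteq> 0"
proof -
  have Q_pos: "Q x > 0" for x
  proof -
    have "p * Q x = (p * x + q / 2)\<^sup>2 + (p - q\<^sup>2 / 4)"
      by (simp add: Q_def power2_eq_square field_simps)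
    also have "\<dots> > 0" using disc by (intro add_nonneg_pos) auto
    finally show ?thesis using p by (simp add: zero_less_mult_iff)
  qed
  \<comment> \<open>\<open>L\<close> drops the sum, which contributes nonnegatively on the positive
    axis. Near 0 the pole \<open>r / x\<close> makes \<open>L\<close> positive, and far out the
    affine part does, so \<open>R\<close> changes sign on either side of \<open>x\<close>.\<close>
  define L where "L = (\<lambda>x::real. Q x * (real r / x) + 2 * A * x + B)"
  have R_ge: "R x \<ge> L x" if "x > 0" for x
  proof -
    have "0 \<le> Q x * (\<Sum>k<n. 1 / (x + l k))"
      using Q_pos[of x] l that by (intro mult_nonneg_nonneg sum_nonneg) (auto intro: add_nonneg_nonneg less_imp_le)
    thus ?thesis by (simp add: R_def L_def algebra_simps)
  qed
  have cont: "continuous_on {0<..} R"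
  proof -
    have "y + l k \<noteq> 0" if "y > 0" for y k
      using l[of k] that by linarith
    thus ?thesis
      unfolding R_def Q_def by (intro continuous_intros) auto
  qed
  have "filterlim L at_top (at_right 0)"
    unfolding L_def Q_def using r by real_asymp
  hence "eventually (\<lambda>y. L y > 0) (at_right 0)"
    by (simp add: filterlim_at_top_dense)
  then obtain u0 where u0: "0 < u0" "u0 < x" "L u0 > 0"
    using x(1) by (auto simp: eventually_at_right_field) (metis dense min_less_iff_conj)
  have "filterlim (\<lambda>y. 2 * A * y + B) at_top at_top"
    using A by real_asymp
  hence "eventually (\<lambda>y. 2 * A * y + B > 0 \<and> y > x) at_top"
    by (simp add: filterlim_at_top_dense eventually_gt_at_top eventually_conj)
  then obtain v0 where v0: "v0 > x" "2 * A * v0 + B > 0"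
    by (auto simp: eventually_at_top_linorder)
  have "0 \<le> Q v0 * (real r / v0)"
    using v0 x(1) Q_pos[of v0] by (intro mult_nonneg_nonneg) auto
  hence "L v0 > 0"
    using v0 by (simp add: L_def)
  note v0 = v0(1) this
  obtain u where u: "u0 \<le> u" "u \<le> x" "R u = 0"
    using IVT2'[of R x 0 u0] u0 x R_ge[of u0] continuous_on_subset[OF cont, of "{u0..x}"] by force
  obtain v where v: "x \<le> v" "v \<le> v0" "R v = 0"
    using IVT'[of R x 0 v0] v0 x R_ge[of v0] continuous_on_subset[OF cont, of "{x..v0}"] by force
  have uv: "0 < u" "u < v" "0 < v"
    using u u0 v x by (auto simp: less_le)
  define QC where "QC = (\<lambda>z::complex. 1 + of_real p * z\<^sup>2 + of_real q * z)"
  define RC where "RC = (\<lambda>z::complex. QC z *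
           (of_nat r / z + (\<Sum>k<n. 1 / (z + of_real (l k)))) + 2 * of_real A * z + of_real B)"
  have QC: "QC (of_real x) = of_real (Q x)" for x
    by (simp add: QC_def Q_def)
  have RC: "RC (of_real x) = of_real (R x)" for x
    by (simp add: RC_def R_def QC)
  \<comment> \<open>\<open>D\<close> is a multiple of the second divided difference at
    \<open>z\<close>, \<open>u\<close>, \<open>v\<close>. It annihilates affine functions, and for a
    function vanishing at \<open>u\<close> and \<open>v\<close> it reduces to the value at
    \<open>z\<close> times \<open>u - v\<close>. Hence \<open>D RC\<close> being nonzero gives the
    claim.\<close>
  define D where "D = (\<lambda>h::complex\<Rightarrow>complex. h z * of_real (u - v) - h (of_real u) * (z - of_real v) + h (of_real v) * (z - of_real u))"
  define h where "h = (\<lambda>c z. QC z / (z + complex_of_real c))"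
  have D_h: "D (h c) = (z - of_real u) * (z - of_real v) * of_real (u - v) *
      (of_real (Q (- c) / ((u + c) * (v + c))) / (z + of_real c))" if "c \<ge> 0" for c
  proof -
    have "z + of_real c \<noteq> 0" "complex_of_real u + of_real c \<noteq> 0" "complex_of_real v + of_real c \<noteq> 0"
      using z that uv by (auto simp: complex_eq_iff)
    from divided_difference_quadratic_over_linear[OF this, of "of_real p" "of_real q"]
    show ?thesis
      using QC[of "- c"] by (simp add: D_def h_def QC_def Q_def mult_ac)
  qed
  have RC_eq: "RC z = of_nat r * h 0 z + (\<Sum>k<n. h (l k) z) + 2 * of_real A * z + of_real B" for z
    by (simp add: RC_def h_def distrib_left sum_distrib_left algebra_simps)
  have "D RC = of_nat r * D (h 0) + (\<Sum>k<n. D (h (l k)))"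
    unfolding D_def RC_eq
    by (simp add: sum.distrib sum_subtractf sum_distrib_right sum_distrib_left algebra_simps)
  also have "\<dots> = (z - of_real u) * (z - of_real v) * of_real (u - v) *
      (of_real (real r * (Q 0 / (u * v))) / (z + of_real 0) + 
       (\<Sum>k<n. of_real (Q (- l k) / ((u + l k) * (v + l k))) / (z + of_real (l k))))"
    using D_h[of 0] D_h[OF less_imp_le[OF l]] by (simp add: sum_distrib_left distrib_left mult_ac)
  also have "\<dots> \<noteq> 0"
  proof -
    have "Im (of_real (real r * (Q 0 / (u * v))) / (z + of_real 0)) < 0"
      using uv r Q_pos[of 0] z by (intro Im_of_real_divide_neg) auto
    moreover have "Im (\<Sum>k<n. of_real (Q (- l k) / ((u + l k) * (v + l k))) / (z + of_real (l k))) \<le> 0"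
      unfolding Im_sum using uv Q_pos l z
      by (intro sum_nonpos less_imp_le[OF Im_of_real_divide_neg] divide_pos_pos mult_pos_pos add_pos_pos) auto
    ultimately have "Im (of_real (real r * (Q 0 / (u * v))) / (z + of_real 0) + 
       (\<Sum>k<n. of_real (Q (- l k) / ((u + l k) * (v + l k))) / (z + of_real (l k)))) < 0"
      unfolding plus_complex.sel by linarith
    hence "of_real (real r * (Q 0 / (u * v))) / (z + of_real 0) + 
       (\<Sum>k<n. of_real (Q (- l k) / ((u + l k) * (v + l k))) / (z + of_real (l k))) \<noteq> 0"
      by (metis less_irrefl zero_complex.sel(2))
    moreover have "z \<noteq> of_real u" "z \<noteq> of_real v" "complex_of_real (u - v) \<noteq> 0"
      using z uv by (auto simp: complex_eq_iff)
    ultimately show ?thesis by (simp only: mult_eq_0_iff right_minus_eq simp_thms)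
  qed
  finally have "RC z \<noteq> 0"
    using RC[of u] RC[of v] u v by (auto simp: D_def)
  thus ?thesis by (simp add: RC_def QC_def)
qed

section \<open>Powers approximating the exponential\<close>

lemma norm_exp_limit_error:
  fixes u :: complex
  assumes m: "m > 0"
  shows "norm ((1 + u / of_nat m) ^ m - exp u) \<le> exp (2 * norm u) * (norm u)\<^sup>2 / real m"
proof -
  define v where "v = u / of_nat m"
  \<comment> \<open>Division by \<open>E\<close> brings both \<open>1 + v\<close> and
    \<open>exp v\<close> into the closed unit disc, where m-th powers differ by at most
    \<open>m\<close> times the difference of the bases. The price is
    \<open>E ^ m = exp (norm u)\<close>, which does not depend on \<open>m\<close>.\<close>
  define E where "E = exp (norm v)"
  have E: "E > 0" "E \<ge> 1" by (simp_all add: E_def)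
  have nv: "norm v = norm u / m" by (simp add: v_def norm_divide)
  have "norm (1 + v) \<le> E"
    using norm_triangle_ineq[of 1 v] exp_ge_add_one_self[of "norm v"] unfolding E_def norm_one by linarith
  hence 1: "norm ((1 + v) / of_real E) \<le> 1" using E by (simp add: norm_divide)
  have 2: "norm (exp v / of_real E) \<le> 1" using E norm_exp[of v] by (simp add: norm_divide E_def)
  have "norm (((1 + v) / of_real E) ^ m - (exp v / of_real E) ^ m) \<le> m * norm ((1 + v) / of_real E - exp v / of_real E)"
    by (rule norm_power_diff[OF 1 2])
  also have "((1 + v) / of_real E) ^ m - (exp v / of_real E) ^ m = ((1 + v) ^ m - exp v ^ m) / of_real (E ^ m)"
    by (simp add: power_divide diff_divide_distrib)
  also have "(1 + v) / of_real E - exp v / of_real E = - (exp v - (1 + v)) / of_real E"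
    by (simp add: diff_divide_distrib)
  finally have le1: "norm ((1 + v) ^ m - exp v ^ m) / E ^ m \<le> m * (norm (exp v - (1 + v)) / E)"
    using E by (simp add: norm_divide norm_power norm_minus_commute)
  have "norm (exp v - (1 + v)) / E \<le> norm (exp v - (1 + v))"
    using E by (simp add: divide_simps mult_le_cancel_left1)
  also have "\<dots> \<le> exp \<bar>Re v\<bar> * norm v ^ 2"
    using Taylor_exp[of v 1] by (simp add: power2_eq_square)
  also have "\<dots> \<le> exp (norm u) * norm v ^ 2"
  proof -
    have "norm v \<le> norm u" using m by (simp add: nv divide_le_eq mult_le_cancel_left1)
    thus ?thesis using abs_Re_le_cmod[of v] by (intro mult_right_mono) auto
  qed
  finally have "norm ((1 + v) ^ m - exp v ^ m) / E ^ m \<le> m * (exp (norm u) * norm v ^ 2)"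
    using le1 order_trans mult_left_mono[OF _ of_nat_0_le_iff] by blast
  hence "norm ((1 + v) ^ m - exp v ^ m) \<le> E ^ m * (m * (exp (norm u) * norm v ^ 2))"
    using E by (simp add: divide_le_eq mult_ac)
  also have "exp v ^ m = exp u" using m by (simp add: v_def flip: exp_of_nat_mult)
  also have "E ^ m = exp (norm u)" using m by (simp add: E_def nv flip: exp_of_nat_mult)
  also have "exp (norm u) * (m * (exp (norm u) * norm v ^ 2)) = exp (2 * norm u) * (norm u)\<^sup>2 / real m"
    using m by (simp add: nv power2_eq_square field_simps flip: exp_add mult_2)
  finally show ?thesis by (simp add: v_def)
qed

lemma uniform_limit_exp_compose:
  fixes u :: "'a \<Rightarrow> complex"
  assumes "\<And>z. z \<in> K \<Longrightarrow> norm (u z) \<le> M"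
  shows "uniform_limit K (\<lambda>m z. (1 + u z / of_nat m) ^ m) (\<lambda>z. exp (u z)) sequentially"
proof (rule uniform_limitI)
  fix e :: real assume e: "e > 0"
  have "(\<lambda>m. exp (2 * M) * M\<^sup>2 / real m) \<longlonglongrightarrow> 0"
    by real_asymp
  hence "\<forall>\<^sub>F m in sequentially. exp (2 * M) * M\<^sup>2 / real m < e"
    using e by (rule order_tendstoD)
  with eventually_gt_at_top[of 0]
  show "\<forall>\<^sub>F m in sequentially. \<forall>z\<in>K. dist ((1 + u z / of_nat m) ^ m) (exp (u z)) < e"
  proof eventually_elim
    case (elim m)
    show ?case
    proof
      fix z assume z: "z \<in> K"
      have "norm ((1 + u z / of_nat m) ^ m - exp (u z)) \<le> exp (2 * norm (u z)) * (norm (u z))\<^sup>2 / real m"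
        using elim by (intro norm_exp_limit_error) auto
      also have "\<dots> \<le> exp (2 * M) * M\<^sup>2 / real m"
        using assms[OF z] by (intro divide_right_mono mult_mono power_mono) auto
      finally show "dist ((1 + u z / of_nat m) ^ m) (exp (u z)) < e"
        using elim by (simp add: dist_norm)
    qed
  qed
qed

text \<open>The exponential prevents \<open>F\<close> from being proper, so it is replaced by the
  power \<open>Q m z ^ m\<close>. The resulting polynomials \<open>P m\<close> are proper and
  converge to \<open>F\<close> uniformly on discs. The hypothesis on \<open>x\<close> says that the
  logarithmic derivative of \<open>F\<close> is negative there, which carries over to
  \<open>R\<close> for large \<open>m\<close>.\<close>

lemma exp_product_upper_inverse:
  fixes l :: "nat \<Rightarrow> real" and A B x :: real and r n :: nat
  assumes r: "r > 0" and A: "A > 0" and l: "\<And>k. l k > 0"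
    and x: "x > 0" "real r / x + (\<Sum>k<n. 1 / (x + l k)) + 2 * A * x + B < 0"
  defines "F \<equiv> \<lambda>z. z ^ r * exp (of_real A * z\<^sup>2 + of_real B * z) * (\<Prod>k<n. 1 + z / of_real (l k))"
  assumes z0: "Im z0 > 0" "Im (F z0) > 0"
  shows "\<exists>g. upper_inverse_through z0 F g"
proof -
  define Q where "Q = (\<lambda>(m::nat) z::complex. 1 + (of_real A * z\<^sup>2 + of_real B * z) / of_nat m)"
  define P where "P = (\<lambda>m z. z ^ r * Q m z ^ m * (\<Prod>k<n. 1 + z / complex_of_real (l k)))"
  have lim: "uniform_limit (cball 0 R) P F sequentially" for R
  proof -
    have comp: "compact (cball (0::complex) R)" by simp
    have bdd: "bounded (h ` cball 0 R)" if "continuous_on UNIV h" for h :: "complex \<Rightarrow> complex"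
      by (intro compact_imp_bounded compact_continuous_image[OF _ comp] continuous_on_subset[OF that]) auto
    obtain M where M: "\<And>z. z \<in> cball 0 R \<Longrightarrow> cmod (of_real A * z\<^sup>2 + of_real B * z) \<le> M"
    proof -
      have "continuous_on UNIV (\<lambda>z. complex_of_real A * z\<^sup>2 + of_real B * z)"
        by (intro continuous_intros)
      from bdd[OF this] show ?thesis
        using that unfolding bounded_iff by (meson imageI)
    qed
    have "uniform_limit (cball 0 R)
       (\<lambda>m z. (z ^ r * (\<Prod>k<n. 1 + z / complex_of_real (l k))) * (1 + (of_real A * z\<^sup>2 + of_real B * z) / of_nat m) ^ m)
       (\<lambda>z. (z ^ r * (\<Prod>k<n. 1 + z / complex_of_real (l k))) * exp (of_real A * z\<^sup>2 + of_real B * z)) sequentially"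
      by (rule uniform_lim_mult[OF uniform_limit_const uniform_limit_exp_compose[OF M]])
         (use l in \<open>auto intro!: bdd continuous_intros simp: less_imp_neq[symmetric]\<close>)
    thus ?thesis
      by (simp add: P_def Q_def F_def mult_ac)
  qed
  have "F holomorphic_on UNIV"
    unfolding F_def using l by (intro holomorphic_intros) (auto simp: less_imp_neq[symmetric])
  hence cont: "continuous_on UNIV F"
    by (rule holomorphic_on_imp_continuous_on)
  have "\<forall>\<^sub>F m in sequentially. B\<^sup>2 / (4 * A) < real m"
    using filterlim_real_sequentially by (simp add: filterlim_at_top_dense)
  moreover have "\<forall>\<^sub>F m in sequentially.
      (1 + (A / m) * x\<^sup>2 + (B / m) * x) * (real r / x + (\<Sum>k<n. 1 / (x + l k))) + 2 * A * x + B < 0"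
  proof -
    have "(\<lambda>m. (1 + (A / real m) * x\<^sup>2 + (B / real m) * x) * (real r / x + (\<Sum>k<n. 1 / (x + l k))) + 2 * A * x + B)
        \<longlonglongrightarrow> (1 + 0 * x\<^sup>2 + 0 * x) * (real r / x + (\<Sum>k<n. 1 / (x + l k))) + 2 * A * x + B"
      by (intro tendsto_intros real_tendsto_divide_at_top filterlim_real_sequentially)
    thus ?thesis using x(2) by (intro order_tendstoD) auto
  qed
  moreover have "\<forall>\<^sub>F m in sequentially. Im (P m z0) > 0"
  proof -
    have "(\<lambda>m. P m z0) \<longlonglongrightarrow> F z0"
      by (rule tendsto_uniform_limitI[OF lim[of "norm z0"]]) simp
    thus ?thesis using z0(2) by (intro order_tendstoD) (auto intro!: tendsto_intros)
  qed
  ultimately have "\<forall>\<^sub>F m in sequentially. \<exists>g. upper_inverse_through z0 (P m) g"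
    using eventually_gt_at_top[of 0]
  proof eventually_elim
    case (elim m)
    show ?case
    proof (rule proper_real_entire_upper_inverse)
      show "P m holomorphic_on UNIV"
        unfolding P_def Q_def using l elim by (intro holomorphic_intros) (auto simp: less_imp_neq[symmetric])
      show "filterlim (P m) at_infinity at_infinity"
      proof -
        have "filterlim (poly [:1, of_real B / of_nat m, of_real A / of_nat m:]) at_infinity (at_infinity :: complex filter)"
          using A elim by (intro filterlim_poly_at_infinity) auto
        also have "poly [:1, of_real B / of_nat m, of_real A / of_nat m:] = Q m"
          using elim by (auto simp: Q_def fun_eq_iff field_simps power2_eq_square)
        finally have Q: "filterlim (Q m) at_infinity at_infinity" .
        have lin: "filterlim (\<lambda>z. 1 + z / complex_of_real c) at_infinity at_infinity" if "c > 0" for c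
        proof -
          have "filterlim (poly [:1, 1 / complex_of_real c:]) at_infinity at_infinity"
            using that by (intro filterlim_poly_at_infinity) auto
          also have "poly [:1, 1 / complex_of_real c:] = (\<lambda>z. 1 + z / of_real c)"
            by (simp add: fun_eq_iff)
          finally show ?thesis .
        qed
        show ?thesis
          unfolding P_def
        proof (induction n)
          case 0
          show ?case
            using filterlim_at_infinity_times[OF Limits.filterlim_power_at_infinity[OF filterlim_ident r]
                Limits.filterlim_power_at_infinity[OF Q elim(4)]] by simp
        next
          case (Suc n)
          thus ?case
            using filterlim_at_infinity_times[OF Suc lin[OF l[of n]]] by (simp add: mult_ac)
        qed
      qed
      show "P m (of_real x) \<in> \<real>" for x
        unfolding P_def Q_def by (intro Reals_mult Reals_power Reals_add Reals_divide prod_in_Reals) auto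
      fix z assume z: "Im z > 0" "Im (P m z) > 0"
      \<comment> \<open>A zero of \<open>Q m\<close> would be a zero of \<open>P m\<close>, where
        the imaginary part of \<open>P m\<close> is not positive.\<close>
      have Qz: "Q m z \<noteq> 0" using z elim by (auto simp: P_def zero_power)
      have "((\<lambda>z. Q m z ^ m) has_field_derivative Q m z ^ m * ((2 * of_real A * z + of_real B) / Q m z)) (at z)"
      proof -
        have DQ: "(Q m has_field_derivative (2 * of_real A * z + of_real B) / of_nat m) (at z)"
          unfolding Q_def using elim by (auto intro!: derivative_eq_intros)
        have "Q m z ^ m = Q m z * Q m z ^ (m - Suc 0)"
          using elim by (simp flip: power_Suc)
        thus ?thesis
          by (intro DERIV_cong[OF DERIV_power[OF DQ]]) (use Qz elim in simp)
      qed
      from has_field_derivative_linear_factors[OF _ _ _ this, of l r n] 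
      have "deriv (P m) z = P m z * (of_nat r / z + (2 * of_real A * z + of_real B) / Q m z
               + (\<Sum>k<n. 1 / (z + of_real (l k))))"
        using l z linear_factor_nonzero[of _ z] unfolding P_def
        by (intro DERIV_imp_deriv) (force simp: complex_eq_iff less_imp_neq[symmetric])
      also have "\<dots> = P m z / Q m z * (Q m z * (of_nat r / z + (\<Sum>k<n. 1 / (z + of_real (l k)))) + 2 * of_real A * z + of_real B)"
        using Qz by (simp add: algebra_simps add_divide_distrib)
      also have "Q m z * (of_nat r / z + (\<Sum>k<n. 1 / (z + of_real (l k)))) + 2 * of_real A * z + of_real B \<noteq> 0"
      proof -
        \<comment> \<open>The eventual lower bound on \<open>m\<close>, read as negativity of the
          discriminant of \<open>Q m\<close>; it makes \<open>Q m\<close> positive on the real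
          axis.\<close>
        have "(B / m)\<^sup>2 < 4 * (A / m)"
          using elim A by (simp add: field_simps power2_eq_square)
        from stieltjes_quotient_nonzero[OF r A _ this l x(1) elim(2) z(1)]
        show ?thesis using A elim by (simp add: Q_def add_divide_distrib add_ac)
      qed
      ultimately show "deriv (P m) z \<noteq> 0" using Qz z by auto
    qed (use z0 elim in auto)
  qed
  thus ?thesis
    by (rule upper_inverse_through_limit[OF _ lim cont z0])
qed

section \<open>The class of functions of genus two\<close>

text \<open>A convex function that is negative at \<open>x0\<close> and zero at a later point
  \<beta> stays above the line through these two points beyond \<beta>. This makes the logarithmic
  derivative positive there and bounded away from 0 beyond \<open>\<beta> + 1\<close>, so the
  function grows at least linearly.\<close>

lemma convex_logarithmic_derivative:
  fixes \<phi> \<phi>' :: "real \<Rightarrow> real"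
  assumes D: "\<And>x. x > 0 \<Longrightarrow> (\<phi> has_real_derivative \<phi>' x) (at x)"
    and pos: "\<And>x. x > 0 \<Longrightarrow> \<phi> x > 0"
    and cvx: "convex_on {0<..} (\<lambda>x. \<phi>' x / \<phi> x)"
    and neg: "x0 > 0" "\<phi>' x0 < 0"
    and min: "\<beta> > 0" "\<forall>\<^sub>F x in nhds \<beta>. \<phi> \<beta> \<le> \<phi> x"
  shows "\<And>x. x > \<beta> \<Longrightarrow> \<phi>' x > 0" "filterlim \<phi> at_top at_top"
proof -
  define \<psi> where "\<psi> = (\<lambda>x. \<phi>' x / \<phi> x)"
  have \<phi>': "\<phi>' x = \<phi> x * \<psi> x" if "x > 0" for x
    using pos[OF that] by (simp add: \<psi>_def)
  have \<psi>_x0: "\<psi> x0 < 0"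
    using neg pos[of x0] by (simp add: \<psi>_def divide_neg_pos)
  \<comment> \<open>Convexity with denominators cleared, so that a zero of \<psi> at an end or in
    the middle simply removes a term.\<close>
  have chord: "\<psi> y * (v - u) \<le> \<psi> u * (v - y) + \<psi> v * (y - u)" if "0 < u" "u \<le> y" "y \<le> v" "u < v" for u v y
  proof -
    define t where "t = (y - u) / (v - u)"
    have t: "0 \<le> t" "t \<le> 1" using that by (auto simp: t_def)
    have tvu: "t * (v - u) = y - u"
      using that by (simp add: t_def)
    hence "y = (1 - t) * u + t * v"
      by (simp add: algebra_simps)
    hence "\<psi> y \<le> (1 - t) * \<psi> u + t * \<psi> v"
      using convex_onD[OF cvx t, of u v] that by (simp add: \<psi>_def)
    hence "\<psi> y * (v - u) \<le> ((1 - t) * \<psi> u + t * \<psi> v) * (v - u)"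
      using that by (intro mult_right_mono) auto
    also have "\<dots> = \<psi> u * ((v - u) - t * (v - u)) + \<psi> v * (t * (v - u))"
      by (simp add: algebra_simps)
    finally show ?thesis by (simp add: tvu)
  qed
  obtain d where d: "d > 0" "\<And>y. \<bar>\<beta> - y\<bar> < d \<Longrightarrow> \<phi> \<beta> \<le> \<phi> y"
    using min(2) unfolding eventually_nhds_metric by (auto simp: dist_real_def abs_minus_commute)
  have "\<phi>' \<beta> = 0"
    using DERIV_local_min[OF D[OF min(1)] d(1)] d(2) by blast
  hence \<psi>_\<beta>: "\<psi> \<beta> = 0" by (simp add: \<psi>_def)
  \<comment> \<open>Otherwise convexity makes \<psi> negative just to the right of \<beta>, and
    \<phi> would decrease from its local minimum.\<close>
  have "x0 < \<beta>"
  proof (rule ccontr)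
    assume "\<not> x0 < \<beta>"
    hence less: "\<beta> < x0" using \<psi>_\<beta> \<psi>_x0 by (cases x0 \<beta> rule: linorder_cases) auto
    have neg_on: "\<phi>' y < 0" if "\<beta> < y" "y \<le> x0" for y
    proof -
      have "\<psi> y * (x0 - \<beta>) \<le> \<psi> x0 * (y - \<beta>)"
        using chord[of \<beta> y x0] that min less by (simp add: \<psi>_\<beta>)
      also have "\<dots> < 0" using \<psi>_x0 that by (simp add: mult_neg_pos)
      finally have "\<psi> y < 0" using less by (simp add: mult_less_0_iff)
      thus ?thesis using \<phi>'[of y] pos[of y] that min by (simp add: mult_pos_neg)
    qed
    define y where "y = Min {x0, \<beta> + d / 2}"
    have y: "\<beta> < y" "y \<le> x0" "\<bar>\<beta> - y\<bar> < d" using less d by (auto simp: y_def)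
    have "\<phi> y < \<phi> \<beta>"
    proof (rule DERIV_neg_imp_decreasing_open[OF y(1)])
      show "\<exists>m. (\<phi> has_real_derivative m) (at x) \<and> m < 0" if "\<beta> < x" "x < y" for x
        using D[of x] neg_on[of x] that y min by auto
      show "continuous_on {\<beta>..y} \<phi>"
        by (intro continuous_at_imp_continuous_on ballI DERIV_isCont[OF D]) (use min in auto)
    qed
    thus False using d(2)[OF y(3)] by simp
  qed
  \<comment> \<open>The slope of the chord from \<open>x0\<close> to \<beta>, where \<psi>
    vanishes.\<close>
  define c where "c = - \<psi> x0 / (\<beta> - x0)"
  have c: "c > 0" using \<psi>_x0 \<open>x0 < \<beta>\<close> by (simp add: c_def divide_neg_pos)
  have \<psi>_ge: "\<psi> x \<ge> c * (x - \<beta>)" if "x \<ge> \<beta>" for x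
    using chord[of x0 \<beta> x] that \<open>x0 < \<beta>\<close> neg by (simp add: \<psi>_\<beta> c_def field_simps)
  show \<phi>'_pos: "\<phi>' x > 0" if "x > \<beta>" for x
  proof -
    have "0 < c * (x - \<beta>)" using c that by simp
    hence "\<psi> x > 0" using \<psi>_ge[of x] that by linarith
    thus ?thesis using \<phi>'[of x] pos[of x] that min by simp
  qed
  have \<phi>_ge: "\<phi> x \<ge> \<phi> (\<beta> + 1)" if "x \<ge> \<beta> + 1" for x
  proof (rule DERIV_nonneg_imp_nondecreasing[OF that])
    fix y assume "\<beta> + 1 \<le> y"
    hence "y > 0" "y > \<beta>" using min by auto
    thus "\<exists>m. (\<phi> has_real_derivative m) (at y) \<and> 0 \<le> m"
      using D \<phi>'_pos less_imp_le by blast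
  qed
  have lin: "\<phi> x \<ge> c * \<phi> (\<beta> + 1) * (x - (\<beta> + 1))" if "x > \<beta> + 1" for x
  proof -
    have "\<exists>z. z > \<beta> + 1 \<and> z < x \<and> \<phi> x - \<phi> (\<beta> + 1) = (x - (\<beta> + 1)) * \<phi>' z"
      by (rule MVT2[OF that]) (use D min in auto)
    then obtain z where z: "z > \<beta> + 1" "\<phi> x - \<phi> (\<beta> + 1) = (x - (\<beta> + 1)) * \<phi>' z" by blast
    have "c * 1 \<le> c * (z - \<beta>)" using c z by (intro mult_left_mono) auto
    hence "c \<le> \<psi> z" using \<psi>_ge[of z] z by linarith
    hence "c * \<phi> (\<beta> + 1) \<le> \<psi> z * \<phi> z"
      using c \<phi>_ge[of z] z pos[of "\<beta> + 1"] min by (intro mult_mono) auto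
    also have "\<psi> z * \<phi> z = \<phi>' z" using \<phi>'[of z] z min by simp
    finally have "(x - (\<beta> + 1)) * (c * \<phi> (\<beta> + 1)) \<le> (x - (\<beta> + 1)) * \<phi>' z"
      using that by (intro mult_left_mono) auto
    thus ?thesis using z(2) pos[of "\<beta> + 1"] min by (simp add: algebra_simps)
  qed
  have "0 < c * \<phi> (\<beta> + 1)" using c pos[of "\<beta> + 1"] min by simp
  hence "filterlim (\<lambda>x. c * \<phi> (\<beta> + 1) * (x - (\<beta> + 1))) at_top at_top"
    by real_asymp
  thus "filterlim \<phi> at_top at_top"
    by (rule filterlim_at_top_mono) (use lin in \<open>auto intro: eventually_mono[OF eventually_gt_at_top[of "\<beta> + 1"]]\<close>)
qed

lemma convex_on_inverse_shift:
  fixes c :: real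
  assumes "c \<ge> 0"
  shows "convex_on {0<..} (\<lambda>x. 1 / (x + c))"
proof (rule convex_onI)
  fix t x y :: real assume t: "0 < t" "t < 1" and xy: "x \<in> {0<..}" "y \<in> {0<..}"
  have "(1 - t) * x + t * y + c = (1 - t) * (x + c) + t * (y + c)"
    by (simp add: algebra_simps)
  thus "1 / ((1 - t) *\<^sub>R x + t *\<^sub>R y + c) \<le> (1 - t) * (1 / (x + c)) + t * (1 / (y + c))"
    using convex_onD[OF convex_on_inverse[OF order_refl], of t "x + c" "y + c"] t xy assms
    by (simp add: inverse_eq_divide)
qed auto

lemma convex_on_LIMSEQ:
  fixes F :: "nat \<Rightarrow> real \<Rightarrow> real"
  assumes F: "\<And>n. convex_on S (F n)" and lim: "\<And>x. x \<in> S \<Longrightarrow> (\<lambda>n. F n x) \<longlonglongrightarrow> f x"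
  shows "convex_on S f"
proof (rule convex_onI)
  show S: "convex S" using F by (rule convex_on_imp_convex)
  fix t x y :: real assume t: "0 < t" "t < 1" and xy: "x \<in> S" "y \<in> S"
  have mem: "(1 - t) *\<^sub>R x + t *\<^sub>R y \<in> S"
    using convexD_alt[OF S xy, of t] t by simp
  show "f ((1 - t) *\<^sub>R x + t *\<^sub>R y) \<le> (1 - t) * f x + t * f y"
  proof (rule LIMSEQ_le[OF lim[OF mem]])
    show "(\<lambda>n. (1 - t) * F n x + t * F n y) \<longlonglongrightarrow> (1 - t) * f x + t * f y"
      by (intro tendsto_intros lim xy)
    show "\<exists>N. \<forall>n\<ge>N. F n ((1 - t) *\<^sub>R x + t *\<^sub>R y) \<le> (1 - t) * F n x + t * F n y"
      using convex_onD[OF F, of t x y] t xy by auto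
  qed
qed

section \<open>The canonical product and its partial products\<close>

locale genus2 =
  fixes r :: nat and a b :: real and l :: "nat \<Rightarrow> real" and f :: "complex \<Rightarrow> complex"
  assumes form: "has_genus2_form r a b l f"
begin

lemma l_pos: "l k > 0"
  and not_summable_l: "\<not> summable (\<lambda>k. 1 / l k ^ 2)"
  and summable_l: "summable (\<lambda>k. 1 / l k ^ 3)"
  and f_eq: "f z = z ^ r * exp (of_real a * z\<^sup>2 + of_real b * z) *
        (\<Prod>k. (1 + z / of_real (l k)) *
              exp (- z / of_real (l k) + z\<^sup>2 / (2 * (of_real (l k))\<^sup>2)))"
  using form by (auto simp: has_genus2_form_def)

lemma l_nonzero [simp]: "l k \<noteq> 0"
  using l_pos[of k] by simp

text \<open>\<open>A n\<close> and \<open>B n\<close> collect the quadratic and linear exponents of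
  the first \<open>n\<close> convergence factors, so that \<open>F n\<close> is a partial product of
  \<open>f\<close> with a single exponential.\<close>

definition A :: "nat \<Rightarrow> real" where "A n = a + (\<Sum>k<n. 1 / (2 * l k ^ 2))"
definition B :: "nat \<Rightarrow> real" where "B n = b - (\<Sum>k<n. 1 / l k)"

definition F :: "nat \<Rightarrow> complex \<Rightarrow> complex" where
  "F n z = z ^ r * exp (of_real (A n) * z\<^sup>2 + of_real (B n) * z) * (\<Prod>k<n. 1 + z / of_real (l k))"

text \<open>The logarithmic derivative of \<open>F n\<close> on the positive axis.\<close>

definition \<psi> :: "nat \<Rightarrow> real \<Rightarrow> real" where
  "\<psi> n x = real r / x + (\<Sum>k<n. 1 / (x + l k)) + 2 * A n * x + B n"

text \<open>Summability of the inverse cubes makes the elementary factors of exponent 2 converge,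
  since \<open>Suc 2\<close> is 3; it also sends the zeros to infinity.\<close>

sublocale W: weierstrass_product "\<lambda>k. - of_real (l k)" "\<lambda>_. 2"
proof
  show "- complex_of_real (l n) \<noteq> 0" for n by simp
  have "(\<lambda>k. 1 / l k ^ 3) \<longlonglongrightarrow> 0"
    using summable_l by (rule summable_LIMSEQ_zero)
  hence "(\<lambda>k. root 3 (1 / l k ^ 3)) \<longlonglongrightarrow> root 3 0"
    by (rule tendsto_real_root)
  hence "(\<lambda>k. inverse (l k)) \<longlonglongrightarrow> 0"
    using l_pos by (simp add: real_root_divide real_root_power_cancel less_imp_le inverse_eq_divide)
  hence "filterlim (\<lambda>k. inverse (inverse (l k))) at_top sequentially"
    using l_pos by (intro filterlim_inverse_at_top) auto
  hence "filterlim (\<lambda>k. norm (- complex_of_real (l k))) at_top sequentially"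
    using l_pos by (simp add: less_imp_le)
  thus "filterlim (\<lambda>k. - complex_of_real (l k)) at_infinity sequentially"
    by (rule filterlim_norm_at_top_imp_at_infinity)
  show "summable (\<lambda>n. (R / norm (- complex_of_real (l n))) ^ Suc 2)" for R
    using summable_mult[OF summable_l, of "R ^ 3"]
    by (simp add: power_divide eval_nat_numeral abs_of_pos[OF l_pos])
qed

lemma factor_eq:
  "weierstrass_factor 2 (z / - of_real (l k)) =
     (1 + z / of_real (l k)) * exp (- z / of_real (l k) + z\<^sup>2 / (2 * (of_real (l k))\<^sup>2))"
  by (simp add: weierstrass_factor_def eval_nat_numeral power2_eq_square mult_ac)

lemma f_eq_weierstrass: "f z = z ^ r * exp (of_real a * z\<^sup>2 + of_real b * z) * W.f z"
  unfolding f_eq W.f_def factor_eq ..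

text \<open>Splitting the exponential into convergence factors again exhibits the partial products,
  whose locally uniform convergence is known.\<close>

lemma F_eq_weierstrass: 
  "F n z = z ^ r * exp (of_real a * z\<^sup>2 + of_real b * z) *
      (\<Prod>k<n. weierstrass_factor 2 (z / - of_real (l k)))"
proof -
  have "(\<Prod>k<n. weierstrass_factor 2 (z / - of_real (l k))) =
      (\<Prod>k<n. 1 + z / of_real (l k)) * exp (\<Sum>k<n. - z / of_real (l k) + z\<^sup>2 / (2 * (of_real (l k))\<^sup>2))"
    unfolding factor_eq by (simp add: prod.distrib exp_sum)
  also have "(\<Sum>k<n. - z / of_real (l k) + z\<^sup>2 / (2 * (of_real (l k))\<^sup>2)) =
      of_real (A n - a) * z\<^sup>2 + of_real (B n - b) * z"
    by (simp add: A_def B_def sum.distrib sum_subtractf sum_negf sum_distrib_right)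
  finally show ?thesis
    by (simp add: F_def algebra_simps flip: exp_add)
qed

lemma f_holomorphic: "f holomorphic_on S"
  unfolding f_eq_weierstrass[abs_def] by (intro holomorphic_intros)

lemma f_continuous_on: "continuous_on S f"
  using f_holomorphic holomorphic_on_imp_continuous_on by blast

lemma F_holomorphic: "F n holomorphic_on S"
  unfolding F_def[abs_def] by (intro holomorphic_intros) auto

lemma F_limit: "uniform_limit (cball 0 R) F f sequentially"
proof -
  define R' where "R' = \<bar>R\<bar> + 1"
  have "compact (cball (0::complex) R')" by simp
  hence bdd: "bounded (h ` cball 0 R')" if "continuous_on UNIV h" for h :: "complex \<Rightarrow> complex"
    by (intro compact_imp_bounded compact_continuous_image continuous_on_subset[OF that]) auto
  have "uniform_limit (cball 0 R') F f sequentially"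
    unfolding F_eq_weierstrass[abs_def] f_eq_weierstrass[abs_def]
    by (intro uniform_lim_mult uniform_limit_const W.uniform_limit bdd continuous_intros
          holomorphic_on_imp_continuous_on W.holomorphic) (simp add: R'_def)
  thus ?thesis
    by (rule uniform_limit_on_subset) (auto simp: R'_def)
qed

lemma F_LIMSEQ: "(\<lambda>n. F n z) \<longlonglongrightarrow> f z"
  by (rule tendsto_uniform_limitI[OF F_limit[of "norm z"]]) simp

lemma f_cnj: "f (cnj z) = cnj (f z)"
proof -
  have "F n (cnj z) = cnj (F n z)" for n
    by (simp add: F_def exp_cnj)
  hence "(\<lambda>n. F n (cnj z)) \<longlonglongrightarrow> cnj (f z)"
    using F_LIMSEQ by (simp add: tendsto_cnj)
  thus ?thesis using F_LIMSEQ LIMSEQ_unique by blast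
qed

lemma has_derivative_on_reals: "(on_reals f has_real_derivative Re (deriv f (of_real x))) (at x)"
  and deriv_real: "deriv f (of_real x) = of_real (Re (deriv f (of_real x)))"
proof -
  have "(f has_field_derivative deriv f (of_real x)) (at (of_real x))"
    using f_holomorphic[of UNIV] by (simp add: holomorphic_derivI)
  hence *: "((\<lambda>x. f (of_real x)) has_vector_derivative deriv f (of_real x)) (at x)"
    by (rule has_vector_derivative_real_field)
  thus "(on_reals f has_real_derivative Re (deriv f (of_real x))) (at x)"
    unfolding on_reals_def[abs_def] by (rule has_field_derivative_Re)
  \<comment> \<open>The imaginary part of \<open>f\<close> vanishes on the real axis, hence so does
    its derivative.\<close>
  have "((\<lambda>x. Im (f (of_real x))) has_real_derivative Im (deriv f (of_real x))) (at x)"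
    using * by (rule has_field_derivative_Im)
  hence "((\<lambda>x. 0) has_real_derivative Im (deriv f (of_real x))) (at x)"
    using has_genus2_form_real[OF form] by simp
  hence "Im (deriv f (of_real x)) = 0"
    using DERIV_const DERIV_unique by blast
  thus "deriv f (of_real x) = of_real (Re (deriv f (of_real x)))"
    by (simp add: complex_eq_iff)
qed

text \<open>The limit of nonnegative partial products is nonnegative; it is nonzero because the
  zeros of the product are the negative numbers \<open>- l k\<close>.\<close>

lemma on_reals_pos:
  assumes x: "x > 0"
  shows "on_reals f x > 0"
proof -
  have "Re (F n (of_real x)) \<ge> 0" for n
  proof -
    have "F n (of_real x) = of_real (x ^ r * exp (A n * x\<^sup>2 + B n * x) * (\<Prod>k<n. 1 + x / l k))"
      unfolding F_def by (simp flip: exp_of_real)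
    moreover have "0 \<le> x ^ r * exp (A n * x\<^sup>2 + B n * x) * (\<Prod>k<n. 1 + x / l k)"
      using x l_pos by (intro mult_nonneg_nonneg prod_nonneg ballI add_nonneg_nonneg divide_nonneg_pos) auto
    ultimately show ?thesis by (simp only: Re_complex_of_real)
  qed
  hence "on_reals f x \<ge> 0"
    unfolding on_reals_def by (intro LIMSEQ_le_const[OF tendsto_Re[OF F_LIMSEQ]]) auto
  moreover have "f (of_real x) \<noteq> 0"
  proof -
    have "of_real x \<noteq> - complex_of_real (l k)" for k
      using x l_pos[of k] by (simp add: complex_eq_iff)
    thus ?thesis using x W.zero[of "of_real x"] by (auto simp: f_eq_weierstrass)
  qed
  ultimately show ?thesis
    using has_genus2_form_real[OF form, of x] by (auto simp: less_le)
qed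

text \<open>Locally uniform limits of holomorphic functions may be differentiated termwise, and
  \<open>f\<close> does not vanish at \<open>x\<close>.\<close>

lemma \<psi>_LIMSEQ:
  assumes x: "x > 0"
  shows "(\<lambda>n. \<psi> n x) \<longlonglongrightarrow> Re (deriv f (of_real x)) / on_reals f x"
proof -
  have F_deriv: "(F n has_field_derivative F n (of_real x) * of_real (\<psi> n x)) (at (of_real x))" for n
  proof -
    have "((\<lambda>z. exp (of_real (A n) * z\<^sup>2 + of_real (B n) * z)) has_field_derivative
            exp (of_real (A n) * (of_real x)\<^sup>2 + of_real (B n) * of_real x) * (2 * of_real (A n) * of_real x + of_real (B n))) (at (of_real x))"
      by (auto intro!: derivative_eq_intros)
    hence "(F n has_field_derivative F n (of_real x) * (of_nat r / of_real x + (2 * of_real (A n) * of_real x + of_real (B n))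
             + (\<Sum>k<n. 1 / (of_real x + of_real (l k))))) (at (of_real x))"
      unfolding F_def[abs_def] using x l_pos
      by (intro has_field_derivative_linear_factors linear_factor_nonzero) auto
    thus ?thesis by (simp add: \<psi>_def algebra_simps)
  qed
  have "\<exists>f'. \<forall>z\<in>UNIV. (f has_field_derivative f' z) (at z) \<and> (\<lambda>n. deriv (F n) z) \<longlonglongrightarrow> f' z"
  proof (rule has_complex_derivative_uniform_sequence[of UNIV F])
    show "(F n has_field_derivative deriv (F n) z) (at z)" for n z
      using F_holomorphic[of n UNIV] by (simp add: holomorphic_derivI)
    fix z :: complex
    have "uniform_limit (cball z 1) F f sequentially"
      by (rule uniform_limit_on_subset[OF F_limit[of "norm z + 1"]]) (simp add: cball_subset_cball_iff)
    thus "\<exists>d>0. cball z d \<subseteq> UNIV \<and> uniform_limit (cball z d) F f sequentially"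
      by (intro exI[of _ 1]) auto
  qed auto
  hence "(\<lambda>n. deriv (F n) (of_real x)) \<longlonglongrightarrow> deriv f (of_real x)"
    by (metis DERIV_imp_deriv UNIV_I)
  hence lim: "(\<lambda>n. F n (of_real x) * of_real (\<psi> n x)) \<longlonglongrightarrow> deriv f (of_real x)"
    using DERIV_imp_deriv[OF F_deriv] by simp
  have f_nz: "f (of_real x) \<noteq> 0"
    using on_reals_pos[OF x] by (auto simp: on_reals_def)
  have "(\<lambda>n. F n (of_real x) * of_real (\<psi> n x) / F n (of_real x)) \<longlonglongrightarrow> deriv f (of_real x) / f (of_real x)"
    by (intro tendsto_divide lim F_LIMSEQ f_nz)
  moreover have "\<forall>\<^sub>F n in sequentially. F n (of_real x) \<noteq> 0"
    using F_LIMSEQ f_nz by (rule tendsto_imp_eventually_ne)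
  ultimately have "(\<lambda>n. complex_of_real (\<psi> n x)) \<longlonglongrightarrow> deriv f (of_real x) / f (of_real x)"
    by (elim Lim_transform_eventually) (auto elim: eventually_mono)
  also have "deriv f (of_real x) / f (of_real x) = of_real (Re (deriv f (of_real x)) / on_reals f x)"
    using deriv_real[of x] has_genus2_form_real[OF form, of x] by simp
  finally show ?thesis by (simp only: tendsto_of_real_iff)
qed

lemma convex_log_deriv: "convex_on {0<..} (\<lambda>x. Re (deriv f (of_real x)) / on_reals f x)"
proof (rule convex_on_LIMSEQ)
  show "convex_on {0<..} (\<psi> n)" for n
  proof -
    have sum: "convex_on {0<..} (\<lambda>x. \<Sum>k<m. 1 / (x + l k))" for m
      by (induction m) (auto simp: convex_on_const intro!: convex_on_add convex_on_inverse_shift less_imp_le[OF l_pos])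
    have "convex_on {0<..} (\<lambda>x. real r * (1 / (x + 0)))"
      by (intro convex_on_cmul convex_on_inverse_shift) auto
    moreover have "convex_on {0<..} (\<lambda>x. 2 * A n * x + B n)"
      by (rule convex_onI) (auto simp: algebra_simps)
    ultimately have "convex_on {0<..} (\<lambda>x. real r * (1 / (x + 0)) + (\<Sum>k<n. 1 / (x + l k)) + (2 * A n * x + B n))"
      by (rule convex_on_add[OF convex_on_add[OF _ sum]])
    thus ?thesis by (simp add: \<psi>_def[abs_def] add.assoc)
  qed
  show "(\<lambda>n. \<psi> n x) \<longlonglongrightarrow> Re (deriv f (of_real x)) / on_reals f x" if "x \<in> {0<..}" for x
    using \<psi>_LIMSEQ that by simp
qed

text \<open>Divergence of the sum of inverse squares outweighs any negative
  \<open>a\<close>.\<close>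

lemma eventually_A_pos: "\<forall>\<^sub>F n in sequentially. A n > 0"
proof -
  obtain N where N: "(\<Sum>k<N. 1 / l k ^ 2) > - 2 * a"
  proof (rule ccontr)
    assume "\<not> thesis"
    hence "(\<Sum>k<N. 1 / l k ^ 2) \<le> - 2 * a" for N
      using that by (meson not_le)
    hence "summable (\<lambda>k. 1 / l k ^ 2)"
      by (intro summableI_nonneg_bounded) auto
    thus False using not_summable_l by blast
  qed
  have "A n > 0" if "n \<ge> N" for n
  proof -
    have "(\<Sum>k<N. 1 / l k ^ 2) \<le> (\<Sum>k<n. 1 / l k ^ 2)"
      using that by (intro sum_mono2) auto
    also have "\<dots> = 2 * (A n - a)"
      by (simp add: A_def sum_distrib_left)
    finally have "- 2 * a < 2 * (A n - a)"
      by (rule less_le_trans[OF N])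
    thus ?thesis by simp
  qed
  thus ?thesis by (auto simp: eventually_sequentially)
qed

text \<open>Negativity of the logarithmic derivative at \<open>x\<close> and positivity of the
  imaginary part at \<open>z0\<close> are open conditions, so \<open>F n\<close> inherits them for
  large \<open>n\<close>.\<close>

lemma upper_inverse_exists:
  assumes r: "r > 0" and x: "x > 0" "Re (deriv f (of_real x)) < 0"
    and z0: "Im z0 > 0" "Im (f z0) > 0"
  shows "\<exists>g. upper_inverse_through z0 f g"
proof (rule upper_inverse_through_limit[OF _ F_limit f_continuous_on z0])
  have "\<forall>\<^sub>F n in sequentially. \<psi> n x < 0"
    using x on_reals_pos[OF x(1)] by (intro order_tendstoD[OF \<psi>_LIMSEQ[OF x(1)]]) (simp add: divide_neg_pos)
  moreover have "\<forall>\<^sub>F n in sequentially. Im (F n z0) > 0"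
    using z0 by (intro order_tendstoD[OF tendsto_Im[OF F_LIMSEQ]])
  ultimately show "\<forall>\<^sub>F n in sequentially. \<exists>g. upper_inverse_through z0 (F n) g"
    using eventually_A_pos
  proof eventually_elim
    case (elim n)
    thus ?case
      using exp_product_upper_inverse[where l = l and A = "A n" and n = n and B = "B n" and ?z0.0 = z0, OF r _ l_pos x(1)] z0
      unfolding \<psi>_def F_def[abs_def] by blast
  qed
qed

end

section \<open>Continuation to the cut plane\<close>

text \<open>The idea of the Noshiro-Warschawski criterion: along the segment from \<open>w\<close>
  to \<open>z\<close>, the real part of \<open>f / (z - w)\<close> has derivative
  \<open>Re (deriv f)\<close>, and the mean value theorem applies.\<close>

lemma Re_difference_quotient_pos:
  assumes holo: "f holomorphic_on UNIV" and "convex N"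
    and pos: "\<And>z. z \<in> N \<Longrightarrow> Re (deriv f z) > 0"
    and zw: "z \<in> N" "w \<in> N" "z \<noteq> w"
  shows "Re ((f z - f w) / (z - w)) > 0"
proof -
  define p where "p = (\<lambda>t::real. w + of_real t * (z - w))"
  define h where "h = (\<lambda>t::real. Re (f (p t) / (z - w)))"
  have p_mem: "p t \<in> N" if "0 \<le> t" "t \<le> 1" for t
  proof -
    have "p t = (1 - t) *\<^sub>R w + t *\<^sub>R z"
      by (simp add: p_def scaleR_conv_of_real algebra_simps)
    thus ?thesis using convexD_alt[OF \<open>convex N\<close> zw(2,1), of t] that by simp
  qed
  have D: "(h has_real_derivative Re (deriv f (p t))) (at t)" for t
  proof -
    have "((\<lambda>s. f (w + s * (z - w)) / (z - w)) has_field_derivative deriv f (p t)) (at (of_real t))"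
    proof -
      have lin: "((\<lambda>s. w + s * (z - w)) has_field_derivative z - w) (at (of_real t))"
        by (auto intro!: derivative_eq_intros)
      have "(f has_field_derivative deriv f (p t)) (at (p t))"
        using holomorphic_derivI[OF holo] by simp
      from DERIV_cdivide[OF DERIV_chain2[OF this[unfolded p_def] lin], of "z - w"] show ?thesis
        using zw(3) by (simp add: p_def)
    qed
    hence "((\<lambda>s. f (w + of_real s * (z - w)) / (z - w)) has_vector_derivative deriv f (p t)) (at t)"
      by (rule has_vector_derivative_real_field)
    thus ?thesis
      unfolding h_def p_def by (rule has_field_derivative_Re)
  qed
  obtain t where t: "0 < t" "t < 1" "h 1 - h 0 = (1 - 0) * Re (deriv f (p t))"
    using MVT2[of 0 1 h "\<lambda>t. Re (deriv f (p t))"] D by auto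
  have "h 1 - h 0 = Re ((f z - f w) / (z - w))"
    by (simp add: h_def p_def diff_divide_distrib)
  thus ?thesis using t pos[OF p_mem[of t]] by simp
qed

section \<open>Rectangles about the real axis on which \<open>f\<close> is injective\<close>

definition box_around :: "real \<Rightarrow> real \<Rightarrow> real \<Rightarrow> complex set" where
  "box_around x1 x2 d = {z. x1 < Re z \<and> Re z < x2 \<and> \<bar>Im z\<bar> < d}"

lemma box_around_eq: "box_around x1 x2 d = {z. Re z > x1} \<inter> {z. Re z < x2} \<inter> {z. Im z > - d} \<inter> {z. Im z < d}"
  by (auto simp: box_around_def)

lemma open_box_around: "open (box_around x1 x2 d)"
  unfolding box_around_eq
  by (intro open_Int open_halfspace_Re_gt open_halfspace_Re_lt open_halfspace_Im_gt open_halfspace_Im_lt)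

lemma convex_box_around: "convex (box_around x1 x2 d)"
  unfolding box_around_eq
  by (intro convex_Int convex_halfspace_Re_gt convex_halfspace_Re_lt convex_halfspace_Im_gt convex_halfspace_Im_lt)

locale real_entire_increasing =
  fixes f :: "complex \<Rightarrow> complex" and \<phi> :: "real \<Rightarrow> real" and \<beta> :: real
  assumes holo: "f holomorphic_on UNIV"
    and real: "f (of_real x) = of_real (\<phi> x)"
    and cnj: "f (cnj z) = cnj (f z)"
    and deriv_pos: "x > \<beta> \<Longrightarrow> Re (deriv f (of_real x)) > 0"
begin

text \<open>Positivity of the real part of the derivative on a convex set gives injectivity.
  Symmetry of the box about the real axis prepares the reflection.\<close>

definition good_box :: "complex set \<Rightarrow> bool" where
  "good_box N \<longleftrightarrow> (\<exists>x1 x2 d. N = box_around x1 x2 d \<and> \<beta> < x1 \<and> d > 0) \<and> (\<forall>z\<in>N. Re (deriv f z) > 0)"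

text \<open>The derivative has positive real part on a compact segment, hence on a neighbourhood of
  uniform width.\<close>

lemma obtain_good_box:
  assumes "\<beta> < x1"
  obtains d where "d > 0" "good_box (box_around x1 x2 d)"
proof -
  have "deriv f holomorphic_on UNIV"
    using holo by (intro holomorphic_deriv) auto
  hence "open {z. Re (deriv f z) > 0}"
    by (intro open_Collect_less continuous_intros holomorphic_on_imp_continuous_on)
  moreover have "compact (complex_of_real ` {x1..x2})"
    by (intro compact_continuous_image continuous_intros) auto
  moreover have "complex_of_real ` {x1..x2} \<subseteq> {z. Re (deriv f z) > 0}"
    using deriv_pos assms by auto
  ultimately obtain d where d: "d > 0" "(\<Union>x\<in>complex_of_real ` {x1..x2}. ball x d) \<subseteq> {z. Re (deriv f z) > 0}"
    using compact_subset_open_imp_ball_epsilon_subset by metis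
  have "Re (deriv f z) > 0" if "z \<in> box_around x1 x2 d" for z
  proof -
    have "dist (complex_of_real (Re z)) z = \<bar>Im z\<bar>"
      by (simp add: dist_norm cmod_def)
    hence "z \<in> ball (complex_of_real (Re z)) d" "Re z \<in> {x1..x2}"
      using that by (auto simp: box_around_def)
    thus ?thesis using d(2) by blast
  qed
  hence "good_box (box_around x1 x2 d)"
    using d assms unfolding good_box_def by blast
  thus ?thesis using that d by blast
qed

lemma good_boxD:
  assumes "good_box N"
  shows "open N" "convex N" "inj_on f N"
    "z \<in> N \<Longrightarrow> Re z > \<beta>" "z \<in> N \<Longrightarrow> cnj z \<in> N"
    "z \<in> N \<Longrightarrow> Im z > 0 \<Longrightarrow> Im (f z) > 0"
proof -
  obtain x1 x2 d where N: "N = box_around x1 x2 d" "\<beta> < x1" "d > 0" and pos: "\<And>z. z \<in> N \<Longrightarrow> Re (deriv f z) > 0"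
    using assms unfolding good_box_def by blast
  show "open N" and cvx: "convex N"
    by (simp_all add: N open_box_around convex_box_around)
  note quot = Re_difference_quotient_pos[OF holo cvx pos]
  show "inj_on f N"
  proof (rule inj_onI, rule ccontr)
    fix z w assume "z \<in> N" "w \<in> N" "f z = f w" "z \<noteq> w"
    thus False using quot[of z w] by simp
  qed
  show "z \<in> N \<Longrightarrow> Re z > \<beta>" "z \<in> N \<Longrightarrow> cnj z \<in> N"
    using N by (auto simp: box_around_def)
  \<comment> \<open>The difference quotient is taken between \<open>z\<close> and its projection
    \<open>Re z\<close>, where \<open>f\<close> is real; the increment is purely imaginary.\<close>
  show "Im (f z) > 0" if "z \<in> N" "Im z > 0"
  proof -
    have eq: "z - of_real (Re z) = \<i> * of_real (Im z)"
      by (simp add: complex_eq_iff)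
    have "of_real (Re z) \<in> N" "z \<noteq> of_real (Re z)"
      using N that by (auto simp: box_around_def complex_eq_iff)
    hence "Re ((f z - f (of_real (Re z))) / (\<i> * of_real (Im z))) > 0"
      using quot[of z "of_real (Re z)"] that eq by simp
    also have "Re ((f z - f (of_real (Re z))) / (\<i> * of_real (Im z))) = Im (f z) / Im z"
      using that by (simp add: real Re_divide power2_eq_square)
    finally show ?thesis using that by (simp add: zero_less_divide_iff)
  qed
qed

text \<open>Identity theorem: agreement at the single point \<open>z1\<close> spreads to a
  neighbourhood by injectivity of \<open>f\<close>, then to the connected upper half of the
  box.\<close>

lemma upper_inverse_on_good_box:
  assumes g: "g holomorphic_on \<H>" "\<And>w. w \<in> \<H> \<Longrightarrow> f (g w) = w"
    and N: "good_box N" and z1: "z1 \<in> N" "Im z1 > 0" "g (f z1) = z1"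
    and z: "z \<in> N" "Im z > 0"
  shows "g (f z) = z"
proof -
  define M where "M = N \<inter> \<H>"
  have M: "open M" "convex M" 
    unfolding M_def using good_boxD[OF N]
    by (auto intro!: convex_Int open_Int open_halfspace_Im_gt convex_halfspace_Im_gt)
  have fM: "f ` M \<subseteq> \<H>"
    using good_boxD(6)[OF N] by (auto simp: M_def)
  have holo': "(\<lambda>z. g (f z)) holomorphic_on M"
    using holomorphic_on_compose_gen[OF holomorphic_on_subset[OF holo] g(1) fM] by (simp add: o_def)
  \<comment> \<open>On \<open>V\<close> the point \<open>g (f y)\<close> is again in the box, so
    \<open>f (g (f y)) = f y\<close> can be cancelled.\<close>
  define V where "V = M \<inter> (\<lambda>z. g (f z)) -` M"
  have "open V"
    unfolding V_def using M holomorphic_on_imp_continuous_on[OF holo'] by (intro continuous_open_preimage)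
  moreover have "z1 \<in> V" using z1 by (simp add: V_def M_def)
  moreover have "g (f y) = y" if "y \<in> V" for y
  proof -
    have "f (g (f y)) = f y" using that fM by (intro g) (auto simp: V_def)
    thus ?thesis using good_boxD(3)[OF N] that by (auto simp: inj_on_def V_def M_def)
  qed
  moreover have "V \<subseteq> M" "z \<in> M"
    using z by (auto simp: V_def M_def)
  ultimately show ?thesis
    using analytic_continuation_open[OF \<open>open V\<close> M(1) _ convex_connected[OF M(2)] \<open>V \<subseteq> M\<close> holo' holomorphic_on_ident _ \<open>z \<in> M\<close>]
    by blast
qed

text \<open>A single branch \<open>g\<close> on the upper half plane is propagated along the half
  line by overlapping boxes, then reflected. It glues holomorphically to the real inverse because
  both agree with local inverses of \<open>f\<close>.\<close>

lemma pick_extension_of_inverse: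
  assumes bij: "bij_betw \<phi> {\<beta><..} {c<..}"
    and inv: "\<And>z0. Im z0 > 0 \<Longrightarrow> Im (f z0) > 0 \<Longrightarrow> \<exists>g. upper_inverse_through z0 f g"
  shows "\<exists>g. pick_function_in_cut_plane c g \<and> inj_on g (cut_plane c) \<and>
           (\<forall>y > c. g (of_real y) = of_real (the_inv_into {\<beta><..} \<phi> y))"
proof -
  define \<phi>i where "\<phi>i = the_inv_into {\<beta><..} \<phi>"
  have \<phi>i: "\<phi>i y > \<beta>" "\<phi> (\<phi>i y) = y" if "y > c" for y
  proof -
    show "\<phi> (\<phi>i y) = y"
      using f_the_inv_into_f_bij_betw[OF bij] that by (simp add: \<phi>i_def)
    show "\<phi>i y > \<beta>"
      using bij_betwE[OF bij_betw_the_inv_into[OF bij]] that by (auto simp: \<phi>i_def)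
  qed
  have \<phi>i_\<phi>: "\<phi>i (\<phi> x) = x" "\<phi> x > c" if "x > \<beta>" for x
    using that bij by (auto simp: \<phi>i_def bij_betw_def the_inv_into_f_f)
  \<comment> \<open>A reference box fixes the branch; any segment of the half line to the right of
    \<beta> would serve.\<close>
  obtain d0 where d0: "d0 > 0" "good_box (box_around (\<beta> + 1) (\<beta> + 2) d0)"
    by (rule obtain_good_box[of "\<beta> + 1" "\<beta> + 2"]) auto
  define z0 where "z0 = Complex (\<beta> + 3 / 2) (d0 / 2)"
  have z0: "z0 \<in> box_around (\<beta> + 1) (\<beta> + 2) d0" "Im z0 > 0"
    using d0 by (auto simp: z0_def box_around_def)
  obtain g where "upper_inverse_through z0 f g"
    using inv[OF z0(2)] good_boxD(6)[OF d0(2) z0] by blast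
  hence g: "g holomorphic_on \<H>" "\<And>w. w \<in> \<H> \<Longrightarrow> Im (g w) > 0" "\<And>w. w \<in> \<H> \<Longrightarrow> f (g w) = w" "g (f z0) = z0"
    by (auto simp: upper_inverse_through_def)
  have good_nbhd: "\<exists>N. good_box N \<and> of_real x \<in> N \<and> (\<forall>z\<in>N. Im z > 0 \<longrightarrow> g (f z) = z)" if x: "x > \<beta>" for x
  proof -
    \<comment> \<open>The endpoints make the new box span both \<open>x\<close> and the reference
      segment, so that its upper half meets that of the reference box, at \<open>z1\<close>.\<close>
    define x1 where "x1 = (\<beta> + min x (\<beta> + 1)) / 2"
    define x2 where "x2 = max x (\<beta> + 2) + 1"
    have x12: "\<beta> < x1" "x1 < x" "x1 < \<beta> + 1" "x < x2" "\<beta> + 2 < x2"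
      using x by (auto simp: x1_def x2_def min_def)
    obtain d where d: "d > 0" "good_box (box_around x1 x2 d)"
      using obtain_good_box[OF x12(1)] by blast
    define z1 where "z1 = Complex (\<beta> + 3 / 2) (min d d0 / 2)"
    have z1: "z1 \<in> box_around (\<beta> + 1) (\<beta> + 2) d0" "z1 \<in> box_around x1 x2 d" "Im z1 > 0"
      using d d0 x12 by (auto simp: z1_def box_around_def)
    have "g (f z1) = z1"
      by (rule upper_inverse_on_good_box[OF g(1,3) d0(2) z0 g(4) z1(1,3)])
    hence "\<forall>z\<in>box_around x1 x2 d. Im z > 0 \<longrightarrow> g (f z) = z"
      using upper_inverse_on_good_box[OF g(1,3) d(2) z1(2,3)] by blast
    moreover have "of_real x \<in> box_around x1 x2 d"
      using x12 d by (simp add: box_around_def)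
    ultimately show ?thesis using d by blast
  qed
  define G where "G = (\<lambda>w. if Im w > 0 then g w else if Im w < 0 then cnj (g (cnj w)) else of_real (\<phi>i (Re w)))"
  have cut: "Im w = 0 \<Longrightarrow> Re w > c \<and> w = of_real (Re w)" if "w \<in> cut_plane c" for w
    using that by (auto simp: cut_plane_def image_iff complex_eq_iff not_less[symmetric])
  have f_G: "f (G w) = w" if w: "w \<in> cut_plane c" for w
    using g(3)[of w] g(3)[of "cnj w"] cut[OF w] \<phi>i[of "Re w"]
    by (cases "Im w" "0::real" rule: linorder_cases) (auto simp: G_def cnj real)
  have openH: "open \<H>" by (rule open_halfspace_Im_gt)
  have G_diff: "G field_differentiable (at w)" if w: "w \<in> cut_plane c" for w
  proof (cases "Im w" "0::real" rule: linorder_cases)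
    case greater
    have "G holomorphic_on \<H>"
      using g(1) by (rule holomorphic_transform) (auto simp: G_def)
    thus ?thesis using greater openH holomorphic_on_imp_differentiable_at by blast
  next
    case less
    have "(cnj \<circ> g \<circ> cnj) holomorphic_on {z. Im z < 0}"
    proof -
      have "cnj ` {z. Im z < 0} = \<H>"
        by (auto intro!: image_eqI[of _ cnj "cnj _"])
      thus ?thesis 
        using g(1) by (intro holomorphic_on_compose_cnj_cnj) (auto simp: open_halfspace_Im_lt)
    qed
    hence "G holomorphic_on {z. Im z < 0}"
      by (rule holomorphic_transform) (auto simp: G_def)
    thus ?thesis using less open_halfspace_Im_lt[of 0] holomorphic_on_imp_differentiable_at by blast
  next
    case equal
    define x where "x = \<phi>i (Re w)"
    have x: "x > \<beta>" "f (of_real x) = w"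
      using cut[OF w equal] \<phi>i[of "Re w"] by (auto simp: x_def real)
    obtain N where N: "good_box N" "of_real x \<in> N" "\<And>z. z \<in> N \<Longrightarrow> Im z > 0 \<Longrightarrow> g (f z) = z"
      using good_nbhd[OF x(1)] by blast
    note N' = good_boxD[OF N(1)]
    obtain h where h: "h holomorphic_on f ` N" "\<And>z. z \<in> N \<Longrightarrow> h (f z) = z"
      by (rule holomorphic_has_inverse[OF holomorphic_on_subset[OF holo subset_UNIV] N'(1,3)], rule that)
    \<comment> \<open>Above, below and on the axis \<open>G\<close> inverts \<open>f\<close>, so
      near \<open>w\<close> it coincides with the holomorphic local inverse
      \<open>h\<close>.\<close>
    have "G (f z) = z" if z: "z \<in> N" for z
    proof (cases "Im z" "0::real" rule: linorder_cases)
      case greater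
      thus ?thesis using N(3)[OF z] N'(6)[OF z] by (simp add: G_def)
    next
      case less
      hence "Im (f (cnj z)) > 0" "g (f (cnj z)) = cnj z"
        using N(3)[of "cnj z"] N'(5)[OF z] N'(6)[of "cnj z"] by auto
      thus ?thesis by (simp add: G_def cnj)
    next
      case equal
      hence "z = of_real (Re z)" by (simp add: complex_eq_iff)
      then obtain t where t: "z = of_real t" by blast
      hence "t > \<beta>" using N'(4)[OF z] by simp
      thus ?thesis using \<phi>i_\<phi> by (simp add: t real G_def)
    qed
    hence "G holomorphic_on f ` N"
      using h by (intro holomorphic_transform[OF h(1)]) auto
    moreover have "open (f ` N)"
      by (rule open_mapping_thm3[OF holomorphic_on_subset[OF holo subset_UNIV] N'(1,3)])
    moreover have "w \<in> f ` N" using N(2) x(2) by blast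
    ultimately show ?thesis using holomorphic_on_imp_differentiable_at by blast
  qed
  have "G holomorphic_on cut_plane c"
    unfolding holomorphic_on_def using G_diff field_differentiable_at_within by blast
  moreover have "\<H> \<subseteq> cut_plane c"
    by (auto simp: cut_plane_def)
  moreover have "Im (G w) \<ge> 0" if "Im w > 0" for w
    using g(2)[of w] that by (simp add: G_def)
  ultimately have "pick_function_in_cut_plane c G"
    unfolding pick_function_in_cut_plane_def pick_function_def using holomorphic_on_subset by blast
  \<comment> \<open>Univalence comes for free: \<open>f\<close> is a left inverse of
    \<open>G\<close> on the whole cut plane.\<close>
  moreover have "inj_on G (cut_plane c)"
    by (rule inj_on_inverseI[of _ f]) (rule f_G)
  moreover have "\<forall>y>c. G (of_real y) = of_real (the_inv_into {\<beta><..} \<phi> y)"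
    by (simp add: G_def \<phi>i_def)
  ultimately show ?thesis by blast
qed

end

text \<open>Bijectivity is part of the conclusion since it makes \<open>the_inv_into\<close> a
  genuine inverse on the half line.\<close>

theorem theorem5p4:
  fixes f :: "complex \<Rightarrow> complex" and r :: nat and a b :: real
    and l :: "nat \<Rightarrow> real" and \<beta> :: real
  assumes "has_genus2_form r a b l f"
    and "f \<in> class_G"
    and "r > 0"
    and "\<beta> > 0"
    and "\<forall>\<^sub>F x in nhds \<beta>. on_reals f \<beta> \<le> on_reals f x"
  shows "strict_mono_on {\<beta><..} (on_reals f) \<and>
         bij_betw (on_reals f) {\<beta><..} {on_reals f \<beta><..} \<and>
         (\<exists>g. pick_function_in_cut_plane (on_reals f \<beta>) g \<and>
              inj_on g (cut_plane (on_reals f \<beta>)) \<and>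
              (\<forall>y > on_reals f \<beta>.
                 g (of_real y) = of_real (the_inv_into {\<beta><..} (on_reals f) y)))"
proof -
  interpret genus2 r a b l f by unfold_locales fact
  let ?\<phi> = "on_reals f"
  obtain u v where uv: "0 \<le> u" "u < v" "strict_antimono_on {u<..<v} ?\<phi>"
    using assms(2) by (auto simp: class_G_def)
  have anti: "?\<phi> y < ?\<phi> x" if "u < x" "x < y" "y < v" for x y
    using uv(3) that by (auto simp: monotone_on_def)
  obtain x0 where x0: "x0 > 0" "Re (deriv f (of_real x0)) < 0"
  proof -
    \<comment> \<open>Interior points of the interval of decrease, so that the mean value theorem
      uses only values inside it and yields a point beyond \<open>u\<close>, hence positive.\<close>
    define s t where "s = (2 * u + v) / 3" and "t = (u + 2 * v) / 3"
    have st: "u < s" "s < t" "t < v" using uv by (auto simp: s_def t_def)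
    obtain x where x: "s < x" "x < t" "?\<phi> t - ?\<phi> s = (t - s) * Re (deriv f (of_real x))"
      using MVT2[OF st(2), of ?\<phi> "\<lambda>x. Re (deriv f (of_real x))"] has_derivative_on_reals by blast
    have "(t - s) * Re (deriv f (of_real x)) < 0"
      using anti[OF st] x(3) by simp
    hence "Re (deriv f (of_real x)) < 0"
      using st by (simp add: mult_less_0_iff)
    thus ?thesis using that[of x] x st uv by simp
  qed
  have deriv_pos: "Re (deriv f (of_real x)) > 0" if "x > \<beta>" for x
    by (rule convex_logarithmic_derivative(1)[OF has_derivative_on_reals on_reals_pos convex_log_deriv x0 assms(4,5) that])
  have at_top: "filterlim ?\<phi> at_top at_top"
    by (rule convex_logarithmic_derivative(2)[OF has_derivative_on_reals on_reals_pos convex_log_deriv x0 assms(4,5)])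
  have cont: "continuous_on S ?\<phi>" for S
    by (intro continuous_at_imp_continuous_on ballI DERIV_isCont[OF has_derivative_on_reals])
  \<comment> \<open>The left endpoint \<beta> is included, which shows that values beyond \<beta>
    exceed the value at \<beta>.\<close>
  have less: "?\<phi> x < ?\<phi> y" if "\<beta> \<le> x" "x < y" for x y
    using that(2)
  proof (rule DERIV_pos_imp_increasing_open)
    fix t assume "x < t" "t < y"
    thus "\<exists>m. (?\<phi> has_real_derivative m) (at t) \<and> m > 0"
      using has_derivative_on_reals deriv_pos that by (metis le_less_trans)
  qed (rule cont)
  have mono: "strict_mono_on {\<beta><..} ?\<phi>"
    by (rule strict_mono_onI) (auto intro: less)
  have bij: "bij_betw ?\<phi> {\<beta><..} {?\<phi> \<beta><..}"
  proof (rule bij_betw_imageI)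
    show "inj_on ?\<phi> {\<beta><..}" using mono by (rule strict_mono_on_imp_inj_on)
    show "?\<phi> ` {\<beta><..} = {?\<phi> \<beta><..}"
    proof (intro equalityI subsetI)
      fix y assume y: "y \<in> {?\<phi> \<beta><..}"
      have "\<forall>\<^sub>F x in at_top. ?\<phi> x > y \<and> x > \<beta>"
        using at_top by (simp add: filterlim_at_top_dense eventually_conj eventually_gt_at_top)
      then obtain X where X: "?\<phi> X > y" "X > \<beta>"
        by (auto simp: eventually_at_top_linorder)
      obtain x where "\<beta> \<le> x" "x \<le> X" "?\<phi> x = y"
        using IVT'[of ?\<phi> \<beta> y X, OF _ _ _ cont] X y by auto
      thus "y \<in> ?\<phi> ` {\<beta><..}"
        using y by (intro image_eqI[of _ _ x]) (auto simp: less_le)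
    qed (auto intro: less)
  qed
  interpret real_entire_increasing f ?\<phi> \<beta>
    by unfold_locales (use f_holomorphic has_genus2_form_real[OF form] f_cnj deriv_pos in auto)
  show ?thesis
    using mono bij pick_extension_of_inverse[OF bij upper_inverse_exists[OF assms(3) x0]] by blast
qed

end
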